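(* Let $0<\gamma<1$. Suppose $f:[0,\infty)\times\mathbb{R}\to\mathbb{R}$, $(t,u)\mapsto f(t,u)$, is continuous and locally Lipschitz in $u$. Let $v$ be a continuous function on an interval $[0,T_v)$ with $v_0=v(0)$, and let $u$ be the strong solution of $D_c^\gamma u=f(t,u)$, $u(0)=u_0$, on its interval of existence $[0,T_b)$. If $D_c^\gamma v\le f(t,v)$ in the distributional sense (on $(0,T_v)$) and $v_0\le u_0$, then $v\le u$ on the common interval $[0,\min(T_v,T_b))$. Similarly, if $D_c^\gamma v\ge f(t,v)$ as distributions and $v_0\ge u_0$, then $v\ge u$ on the common interval.
   Context: Generalized Caputo derivative. For $0<\gamma<1$, $u\in L^1_{\mathrm{loc}}[0,T)$ (integrable on $[0,T']$ for every $T'<T$) and $u_0\in\mathbb{R}$, the $\gamma$-th order generalized Caputo derivative of $u$ associated with initial value $u_0$ is the distribution in $\mathscr{D}'(-\infty,T)$, supported in $[0,T)$, $$D_c^\gamma u=g_{-\gamma}*\big((u-u_0)\theta\big),\qquad g_{-\gamma}=\frac{1}{\Gamma(1-\gamma)}D\big(\theta(t)t^{-\gamma}\big),$$ where $\theta$ is the Heaviside function and $D$ the distributional derivative. Equivalently, $D_c^\gamma u$ is the distributional derivative on $(-\infty,T)$ of the locally integrable function equal to $\frac{1}{\Gamma(1-\gamma)}\int_0^t(t-s)^{-\gamma}(u(s)-u_0)\,ds$ for $t>0$ and $0$ for $t<0$. Here $D_c^\gamma v$ is taken with initial value $v_0=v(0)$ and $D_c^\gamma u$ with initial value $u_0$.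 Strong solution. $u\in L^1_{\mathrm{loc}}[0,T)$ is a strong solution of $D_c^\gamma u=f(t,u)$ on $[0,T)$ with initial value $u_0$ if $\lim_{t\to0^+}\frac1t\int_0^t|u(s)-u_0|\,ds=0$, both $D_c^\gamma u$ and $f(t,u(t))$ are locally integrable on $[0,T)$, and the equation holds in $\mathscr{D}'(-\infty,T)$ (with $f(t,u(t))$ extended by zero to $t<0$). It is known that for $f$ continuous and locally Lipschitz in $u$ there is a unique strong solution, continuous on its maximal interval of existence $[0,T_b)$, $T_b\in(0,\infty]$. It satisfies $u(t)=u_0+\frac1{\Gamma(\gamma)}\int_0^t(t-s)^{\gamma-1}f(s,u(s))\,ds$. "Locally Lipschitz in $u$" means: for every compact set $[0,T]\times[-M,M]$ there is $L$ with $|f(t,u)-f(t,v)|\le L|u-v|$ on it. Order on distributions: for an open interval $U$ and $f_1,f_2\in\mathscr{D}'(U)$, $f_1\le f_2$ in the distributional sense means $\langle f_1-f_2,\varphi\rangle\le0$ for all $\varphi\in C_c^\infty(U)$ with $\varphi\ge0$; $f_1\ge f_2$ means $f_2\le f_1$. *)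

theory Defs
  imports "HOL-Analysis.Analysis"
begin

text \<open>
  Distributions on an open set are represented by their action on test functions; a functional on
  all of \<open>real \<Rightarrow> real\<close> is used, and only its values on the test functions of the open set matter.
  The end points of the time intervals may be infinite, hence have type \<^typ>\<open>ereal\<close>;
  \<open>einterval a b\<close> is the open interval $(a,b)$.
\<close>

type_synonym distr = "(real \<Rightarrow> real) \<Rightarrow> real"

definition test_functions :: "real set \<Rightarrow> (real \<Rightarrow> real) set" where
  "test_functions U =
     {\<phi>. (\<forall>n x. (deriv ^^ n) \<phi> differentiable (at x)) \<and>
         compact (closure {x. \<phi> x \<noteq> 0}) \<and> closure {x. \<phi> x \<noteq> 0} \<subseteq> U}"

definition regular_distr :: "real set \<Rightarrow> (real \<Rightarrow> real) \<Rightarrow> distr" where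
  "regular_distr U h = (\<lambda>\<phi>. LINT x:U|lebesgue. h x * \<phi> x)"

definition distr_deriv :: "distr \<Rightarrow> distr" where
  "distr_deriv S = (\<lambda>\<phi>. - S (deriv \<phi>))"

definition distr_eq_on :: "real set \<Rightarrow> distr \<Rightarrow> distr \<Rightarrow> bool" where
  "distr_eq_on U S R \<longleftrightarrow> (\<forall>\<phi>\<in>test_functions U. S \<phi> = R \<phi>)"

definition distr_le_on :: "real set \<Rightarrow> distr \<Rightarrow> distr \<Rightarrow> bool" where
  "distr_le_on U S R \<longleftrightarrow> (\<forall>\<phi>\<in>test_functions U. (\<forall>x. 0 \<le> \<phi> x) \<longrightarrow> S \<phi> - R \<phi> \<le> 0)"

text \<open>Integrability on $[0,b]$ for every $b < T$; not merely on compact subsets of $(0,T)$.\<close>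

definition locally_integrable :: "ereal \<Rightarrow> (real \<Rightarrow> real) \<Rightarrow> bool" where
  "locally_integrable T h \<longleftrightarrow> (\<forall>b. ereal b < T \<longrightarrow> h absolutely_integrable_on {0..b})"

definition zero_ext :: "(real \<Rightarrow> real) \<Rightarrow> real \<Rightarrow> real" where
  "zero_ext h t = (if 0 \<le> t then h t else 0)"

text \<open>
  The convolution of $\theta(t)\,t^{-\gamma}/\Gamma(1-\gamma)$ with $(u-u_0)\theta$. The generalized
  Caputo derivative $g_{-\gamma} * ((u-u_0)\theta)$ is its distributional derivative on
  $(-\infty,T)$, since $g_{-\gamma}$ is the distributional derivative of the first factor.
\<close>

definition caputo_primitive :: "real \<Rightarrow> real \<Rightarrow> (real \<Rightarrow> real) \<Rightarrow> real \<Rightarrow> real" where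
  "caputo_primitive \<gamma> u0 u t =
     (if 0 < t
      then 1 / Gamma (1 - \<gamma>) * (LINT s:{0..t}|lebesgue. (t - s) powr (- \<gamma>) * (u s - u0))
      else 0)"

definition caputo :: "real \<Rightarrow> ereal \<Rightarrow> real \<Rightarrow> (real \<Rightarrow> real) \<Rightarrow> distr" where
  "caputo \<gamma> T u0 u = distr_deriv (regular_distr (einterval (-\<infinity>) T) (caputo_primitive \<gamma> u0 u))"

definition strong_solution ::
  "real \<Rightarrow> (real \<Rightarrow> real \<Rightarrow> real) \<Rightarrow> real \<Rightarrow> ereal \<Rightarrow> (real \<Rightarrow> real) \<Rightarrow> bool" where
  "strong_solution \<gamma> f u0 T u \<longleftrightarrow>
     0 < T \<and>
     locally_integrable T u \<and>
     ((\<lambda>t. 1 / t * (LINT s:{0..t}|lebesgue. \<bar>u s - u0\<bar>)) \<longlongrightarrow> 0) (at_right 0) \<and>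
     (\<exists>g. locally_integrable T g \<and>
          distr_eq_on (einterval (-\<infinity>) T) (caputo \<gamma> T u0 u)
            (regular_distr (einterval (-\<infinity>) T) (zero_ext g))) \<and>
     locally_integrable T (\<lambda>t. f t (u t)) \<and>
     distr_eq_on (einterval (-\<infinity>) T) (caputo \<gamma> T u0 u)
       (regular_distr (einterval (-\<infinity>) T) (zero_ext (\<lambda>t. f t (u t))))"

definition time_interval :: "ereal \<Rightarrow> real set" where
  "time_interval T = {t. 0 \<le> t \<and> ereal t < T}"

text \<open>
  Strong solutions are classes modulo null sets; the pointwise statements are about the continuous
  representative. Maximality: this representative has no continuous strong extension.
\<close>

definition maximal_strong_solution ::
  "real \<Rightarrow> (real \<Rightarrow> real \<Rightarrow> real) \<Rightarrow> real \<Rightarrow> ereal \<Rightarrow> (real \<Rightarrow> real) \<Rightarrow> bool" where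
  "maximal_strong_solution \<gamma> f u0 T u \<longleftrightarrow>
     strong_solution \<gamma> f u0 T u \<and> continuous_on (time_interval T) u \<and>
     \<not> (\<exists>T' w. T < T' \<and> strong_solution \<gamma> f u0 T' w \<and> continuous_on (time_interval T') w \<and>
               (\<forall>t\<in>time_interval T. w t = u t))"

definition locally_lipschitz_snd :: "(real \<Rightarrow> real \<Rightarrow> real) \<Rightarrow> bool" where
  "locally_lipschitz_snd f \<longleftrightarrow> (\<forall>T M. \<exists>L. \<forall>t\<in>{0..T}. L-lipschitz_on {-M..M} (f t))"

end

theory Submission
  imports Defs
begin

text \<open>
  Let $w$ be the lower function minus the upper one. Testing with differences of shifted smooth steps
  shows that the (continuous) difference of the two Caputo primitives increases on every interval
  where $0 < w \le \varepsilon$ at rate at most $L\varepsilon$. If $w$ became positive, let $\tau$ be the infimum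
  of the times where $w > 0$ and $t_0$ a maximum point of $w$ on $[0,\tau+\rho]$ with $\rho$ small,
  $\varepsilon = w(t_0)$, and take $t_1 \in (\tau,t_0)$ with $w > 0$ on $(t_1,t_0]$. Then
  $q = \varepsilon - w \ge 0$ on $[t_1,t_0]$, and its fractional integral
  $\int_{t_1}^t (t-s)^{-\gamma} q(s)\,ds$ increases at rate at least $\varepsilon$, because the singular kernel
  contributes $\varepsilon (t-\tau)^{-\gamma} \ge \varepsilon \rho^{-\gamma}$ while the history before $t_1$ has
  a favourable sign. Inverting this Abel transform gives
  $\int_{t_0-\eta}^{t_0} q \ge c\,\eta$ with $c > 0$ for all small $\eta$, contradicting $q(t_0) = 0$.
\<close>

section \<open>Smooth compactly supported step functions\<close>

text \<open>The recursion passes to \<open>deriv f\<close>, so closure properties follow by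
  induction with the function left arbitrary. \<open>ndiff_imp_differentiable\<close> translates
  back to the iterates \<open>deriv ^^ n\<close> that occur in
  \<open>test_functions\<close>.\<close>

primrec ndiff :: "nat \<Rightarrow> (real \<Rightarrow> real) \<Rightarrow> bool" where
  "ndiff 0 f = True"
| "ndiff (Suc n) f = ((\<forall>x. f differentiable (at x)) \<and> ndiff n (deriv f))"

lemma ndiff_SucD: "ndiff (Suc n) f \<Longrightarrow> ndiff n f"
  by (induction n arbitrary: f) auto

lemma ndiff_imp_differentiable: "ndiff (Suc n) f \<Longrightarrow> (deriv ^^ n) f differentiable (at x)"
  by (induction n arbitrary: f) (auto simp: funpow_swap1 simp del: funpow.simps(2) simp: funpow_Suc_right)

lemma ndiff_const: "ndiff n (\<lambda>x. c)"
  by (induction n arbitrary: c) auto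

lemma ndiff_add: "ndiff n f \<Longrightarrow> ndiff n g \<Longrightarrow> ndiff n (\<lambda>x. f x + g x)"
proof (induction n arbitrary: f g)
  case (Suc n)
  have D: "((\<lambda>x. f x + g x) has_real_derivative deriv f x + deriv g x) (at x)" for x
    using Suc.prems by (auto intro!: derivative_eq_intros simp: DERIV_deriv_iff_real_differentiable)
  then have "deriv (\<lambda>x. f x + g x) = (\<lambda>x. deriv f x + deriv g x)"
    by (auto intro!: DERIV_imp_deriv)
  moreover have "\<forall>x. (\<lambda>x. f x + g x) differentiable (at x)"
    using D real_differentiable_def by blast
  ultimately show ?case
    using Suc by simp
qed simp

lemma ndiff_mult: "ndiff n f \<Longrightarrow> ndiff n g \<Longrightarrow> ndiff n (\<lambda>x. f x * g x)"
proof (induction n arbitrary: f g)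
  case (Suc n)
  have D: "((\<lambda>x. f x * g x) has_real_derivative deriv f x * g x + f x * deriv g x) (at x)" for x
    using DERIV_mult[of f "deriv f x" x UNIV g "deriv g x"] Suc.prems
    by (simp add: DERIV_deriv_iff_real_differentiable mult.commute)
  then have "deriv (\<lambda>x. f x * g x) = (\<lambda>x. deriv f x * g x + f x * deriv g x)"
    by (auto intro!: DERIV_imp_deriv)
  moreover have "\<forall>x. (\<lambda>x. f x * g x) differentiable (at x)"
    using D real_differentiable_def by blast
  moreover have "ndiff n (\<lambda>x. deriv f x * g x + f x * deriv g x)"
    using Suc.prems ndiff_SucD[OF Suc.prems(1)] ndiff_SucD[OF Suc.prems(2)]
    by (intro ndiff_add Suc.IH) auto
  ultimately show ?case
    by simp
qed simp

lemma ndiff_affine: "ndiff n f \<Longrightarrow> ndiff n (\<lambda>x. f (c * x + d))"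
proof (induction n arbitrary: f)
  case (Suc n)
  have D: "((\<lambda>x. f (c * x + d)) has_real_derivative c * deriv f (c * x + d)) (at x)" for x
  proof -
    have "(f has_real_derivative deriv f (c * x + d)) (at (c * x + d))"
      using Suc.prems by (auto simp: DERIV_deriv_iff_real_differentiable)
    then have "((\<lambda>x. f (c * x + d)) has_real_derivative deriv f (c * x + d) * c) (at x)"
      by (rule DERIV_chain2) (auto intro!: derivative_eq_intros)
    then show ?thesis by (simp add: mult.commute)
  qed
  then have "deriv (\<lambda>x. f (c * x + d)) = (\<lambda>x. c * deriv f (c * x + d))"
    by (auto intro!: DERIV_imp_deriv)
  moreover have "\<forall>x. (\<lambda>x. f (c * x + d)) differentiable (at x)"
    using D real_differentiable_def by blast
  moreover have "ndiff n (\<lambda>x. c * deriv f (c * x + d))"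
    using Suc by (intro ndiff_mult ndiff_const) auto
  ultimately show ?case
    by simp
qed simp

text \<open>The polynomial parameter makes the family closed under differentiation, so that
  smoothness of exp(-1/x), the case \<open>p = 1\<close>, becomes a single induction.\<close>

definition flat :: "real poly \<Rightarrow> real \<Rightarrow> real" where
  "flat p x = (if 0 < x then poly p (1 / x) * exp (- (1 / x)) else 0)"

lemma tendsto_poly_mult_exp_minus:
  fixes p :: "real poly"
  shows "((\<lambda>y. poly p y * exp (- y)) \<longlongrightarrow> 0) at_top"
proof -
  have "((\<lambda>y. \<Sum>i\<le>degree p. coeff p i * (y ^ i / exp y)) \<longlongrightarrow> (\<Sum>i\<le>degree p. coeff p i * 0)) at_top"
    by (intro tendsto_intros tendsto_power_div_exp_0)
  then show ?thesis
    by (simp add: poly_altdef exp_minus sum_distrib_right divide_inverse mult.assoc)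
qed

lemma flat_tendsto_0: "((\<lambda>x. flat p x) \<longlongrightarrow> 0) (at 0)"
proof -
  have "((\<lambda>x. poly p (inverse x) * exp (- inverse x)) \<longlongrightarrow> 0) (at_right 0)"
    by (rule filterlim_compose[OF tendsto_poly_mult_exp_minus filterlim_inverse_at_top_right])
  then have "(flat p \<longlongrightarrow> 0) (at_right 0)"
    by (rule Lim_transform_eventually)
      (auto simp: flat_def eventually_at_filter inverse_eq_divide)
  moreover have "(flat p \<longlongrightarrow> 0) (at_left 0)"
    by (rule tendsto_eventually) (auto simp: flat_def eventually_at_filter)
  ultimately show ?thesis
    by (simp add: filterlim_split_at)
qed

text \<open>For x > 0 put y = 1/x, so that dy/dx = -y^2; this produces the factor
  \<open>monom 1 2\<close> and the difference of p and its derivative. Only x = 0 needs a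
  limit.\<close>

lemma DERIV_flat: "(flat p has_real_derivative flat (monom 1 2 * (p - pderiv p)) x) (at x)"
proof (cases x "0 :: real" rule: linorder_cases)
  case less
  have "(flat p has_real_derivative 0) (at x)"
    by (rule has_field_derivative_transform_within_open[of "\<lambda>_. 0" _ _ "{..<0}"])
      (use less in \<open>auto simp: flat_def\<close>)
  then show ?thesis
    using less by (simp add: flat_def)
next
  case equal
  \<comment> \<open>\<open>pCons 0 p\<close> is p times its variable, here 1/x, so the difference
    quotient at 0 is again a flat function.\<close>
  have "((\<lambda>x. flat (pCons 0 p) x) \<longlongrightarrow> 0) (at 0)"
    by (rule flat_tendsto_0)
  then have "((\<lambda>y. (flat p y - flat p 0) / (y - 0)) \<longlongrightarrow> 0) (at 0)"
    by (rule Lim_transform_eventually) (auto simp: flat_def eventually_at_filter)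
  then show ?thesis
    using equal by (simp add: has_field_derivative_iff flat_def)
next
  case greater
  have "((\<lambda>x. poly p (1 / x) * exp (- (1 / x))) has_real_derivative
      poly (monom 1 2 * (p - pderiv p)) (1 / x) * exp (- (1 / x))) (at x)"
    using greater
    by (auto intro!: derivative_eq_intros DERIV_chain2[where f = "poly p"] poly_DERIV
        simp: poly_monom field_simps power2_eq_square)
  then have "(flat p has_real_derivative
      poly (monom 1 2 * (p - pderiv p)) (1 / x) * exp (- (1 / x))) (at x)"
    by (rule has_field_derivative_transform_within_open[of _ _ _ "{0<..}"])
      (use greater in \<open>auto simp: flat_def\<close>)
  then show ?thesis
    using greater by (simp add: flat_def)
qed

lemma ndiff_flat: "ndiff n (flat p)"
proof (induction n arbitrary: p)
  case (Suc n)
  have "deriv (flat p) = flat (monom 1 2 * (p - pderiv p))"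
    by (auto intro!: DERIV_imp_deriv DERIV_flat)
  then show ?case
    using Suc DERIV_flat real_differentiable_def by auto
qed simp

section \<open>Bumps supported in an interval and their antiderivatives\<close>

definition bump :: "real \<Rightarrow> real \<Rightarrow> real" where
  "bump \<epsilon> x = flat 1 x * flat 1 (\<epsilon> - x)"

lemma ndiff_bump: "ndiff n (bump \<epsilon>)"
proof -
  have "ndiff n (\<lambda>x. flat 1 x * flat 1 ((-1) * x + \<epsilon>))"
    by (intro ndiff_mult ndiff_flat ndiff_affine)
  then show ?thesis
    by (simp add: bump_def[abs_def])
qed

lemma bump_nonneg: "0 \<le> bump \<epsilon> x"
  by (simp add: bump_def flat_def)

lemma bump_eq_0: "x \<le> 0 \<or> \<epsilon> \<le> x \<Longrightarrow> bump \<epsilon> x = 0"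
  by (auto simp: bump_def flat_def)

lemma bump_pos: "0 < x \<Longrightarrow> x < \<epsilon> \<Longrightarrow> 0 < bump \<epsilon> x"
  by (auto simp: bump_def flat_def)

lemma continuous_on_bump [continuous_intros]: "continuous_on S (bump \<epsilon>)"
  using ndiff_bump[of "Suc 0" \<epsilon>]
  by (auto intro!: differentiable_imp_continuous_on simp: differentiable_on_def differentiable_at_withinI)


text \<open>The bump vanishes left of 0, so starting at -1 loses nothing and keeps 0 inside the
  interval of integration, where the fundamental theorem gives a two-sided derivative. There is no
  normalisation: the plateau has height \<open>step \<epsilon> \<epsilon>\<close>.\<close>

definition step :: "real \<Rightarrow> real \<Rightarrow> real" where
  "step \<epsilon> x = integral {-1..x} (bump \<epsilon>)"

lemma step_eq_0: "x \<le> 0 \<Longrightarrow> step \<epsilon> x = 0"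
  unfolding step_def
  by (subst Henstock_Kurzweil_Integration.integral_cong[where g = "\<lambda>_. 0"]) (auto simp: bump_eq_0)

lemma DERIV_step: "(step \<epsilon> has_real_derivative bump \<epsilon> x) (at x)"
proof (cases "x < 0")
  case True
  have "(step \<epsilon> has_real_derivative 0) (at x)"
    by (rule has_field_derivative_transform_within_open[of "\<lambda>_. 0" _ _ "{..<0}"])
      (use True in \<open>auto simp: step_eq_0\<close>)
  then show ?thesis
    using True by (simp add: bump_eq_0)
next
  case False
  have "((\<lambda>x. integral {-1..x} (bump \<epsilon>)) has_real_derivative bump \<epsilon> x) (at x within {-1..x+1})"
    using False by (intro integral_has_real_derivative continuous_intros) auto
  moreover have "at x within {-1..x+1} = at x"
    using False by (intro at_within_interior) auto
  ultimately show ?thesis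
    by (simp add: step_def[abs_def])
qed

lemma DERIV_step_shift [derivative_intros]:
  "((\<lambda>x. step \<epsilon> (x - a)) has_real_derivative bump \<epsilon> (x - a)) (at x within S)"
proof -
  have "((\<lambda>x. step \<epsilon> (x - a)) has_real_derivative bump \<epsilon> (x - a) * 1) (at x)"
    by (rule DERIV_chain2[OF DERIV_step]) (auto intro!: derivative_eq_intros)
  then show ?thesis
    by (simp add: has_field_derivative_at_within)
qed

lemma step_mono: "x \<le> y \<Longrightarrow> step \<epsilon> x \<le> step \<epsilon> y"
  by (rule DERIV_nonneg_imp_nondecreasing) (use DERIV_step bump_nonneg in blast)+

lemma step_eq_const:
  assumes "\<epsilon> \<le> x"
  shows "step \<epsilon> x = step \<epsilon> \<epsilon>"
proof -
  have "continuous_on {\<epsilon>..x+1} (step \<epsilon>)"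
    by (rule DERIV_continuous_on) (use DERIV_step has_field_derivative_at_within in blast)
  moreover have "DERIV (step \<epsilon>) y :> 0" if "\<epsilon> < y" for y
    using DERIV_step[of \<epsilon> y] that by (simp add: bump_eq_0)
  ultimately show ?thesis
    using assms by (intro DERIV_isconst2[of \<epsilon> "x+1"]) auto
qed

lemma step_pos:
  assumes "0 < \<epsilon>"
  shows "0 < step \<epsilon> \<epsilon>"
proof -
  have "step \<epsilon> 0 < step \<epsilon> \<epsilon>"
  proof (rule DERIV_pos_imp_increasing_open[OF assms])
    show "\<exists>y. DERIV (step \<epsilon>) x :> y \<and> 0 < y" if "0 < x" "x < \<epsilon>" for x
      using DERIV_step[of \<epsilon> x] bump_pos[OF that] by blast
    show "continuous_on {0..\<epsilon>} (step \<epsilon>)"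
      by (rule DERIV_continuous_on) (use DERIV_step has_field_derivative_at_within in blast)
  qed
  then show ?thesis
    by (simp add: step_eq_0)
qed

lemma ndiff_step_shift: "ndiff n (\<lambda>x. step \<epsilon> (x - a))"
proof -
  have "deriv (step \<epsilon>) = bump \<epsilon>"
    by (auto intro!: DERIV_imp_deriv DERIV_step)
  then have "ndiff (Suc n) (step \<epsilon>)"
    using DERIV_step real_differentiable_def by (auto intro: ndiff_bump)
  from ndiff_affine[OF ndiff_SucD[OF this], of 1 "-a"] show ?thesis
    by simp
qed

text \<open>A smoothed indicator of [a, b]: left of a both steps vanish, and right of b + \<epsilon>
  both have reached the same plateau and cancel.\<close>

lemma step_diff_test_function:
  assumes "a \<le> b" "0 \<le> \<epsilon>" "{a..b + \<epsilon>} \<subseteq> U"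
  shows "(\<lambda>x. step \<epsilon> (x - a) - step \<epsilon> (x - b)) \<in> test_functions U"
proof -
  let ?\<phi> = "\<lambda>x. step \<epsilon> (x - a) - step \<epsilon> (x - b)"
  have "ndiff n (\<lambda>x. step \<epsilon> (x - a) + (- 1) * step \<epsilon> (x - b))" for n
    by (intro ndiff_add ndiff_mult ndiff_const ndiff_step_shift)
  then have "(deriv ^^ n) ?\<phi> differentiable (at x)" for n x
    using ndiff_imp_differentiable[of n ?\<phi>] by (simp del: ndiff.simps)
  moreover have sub: "{x. ?\<phi> x \<noteq> 0} \<subseteq> {a..b + \<epsilon>}"
  proof (intro subsetI, rule ccontr)
    fix x assume x: "x \<in> {x. ?\<phi> x \<noteq> 0}" "x \<notin> {a..b + \<epsilon>}"
    then consider "x < a" | "b + \<epsilon> < x"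
      by fastforce
    then show False
      using x assms step_eq_const[of \<epsilon> "x - a"] step_eq_const[of \<epsilon> "x - b"]
      by cases (auto simp: step_eq_0)
  qed
  moreover have "closure {x. ?\<phi> x \<noteq> 0} \<subseteq> {a..b + \<epsilon>}"
    using sub by (simp add: closure_minimal)
  moreover have "bounded {x. ?\<phi> x \<noteq> 0}"
    using sub bounded_closed_interval bounded_subset by blast
  ultimately show ?thesis
    using assms(3) by (auto simp: test_functions_def)
qed

section \<open>Distributional derivatives bounded above\<close>

lemma set_integral_eq_integral_of_support:
  fixes g :: "real \<Rightarrow> real"
  assumes "continuous_on {p..q} g" "\<And>x. x \<notin> {p..q} \<inter> U \<Longrightarrow> g x = 0"
  shows "(LINT x:U|lebesgue. g x) = integral {p..q} g"
proof -
  have "(LINT x:U|lebesgue. g x) = (LINT x:{p..q}|lebesgue. g x)"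
    unfolding set_lebesgue_integral_def
    by (intro Bochner_Integration.integral_cong) (use assms(2) in \<open>auto simp: indicator_def\<close>)
  also have "\<dots> = integral {p..q} g"
    using assms(1) by (intro set_lebesgue_integral_eq_integral absolutely_integrable_continuous_real)
  finally show ?thesis .
qed

lemma test_function_continuous:
  assumes "\<phi> \<in> test_functions U"
  shows "continuous_on S \<phi>" "continuous_on S (deriv \<phi>)"
proof -
  have "(deriv ^^ n) \<phi> differentiable (at x within S)" for n x
    using assms by (simp add: test_functions_def differentiable_at_withinI)
  from this[of 0] this[of 1] show "continuous_on S \<phi>" "continuous_on S (deriv \<phi>)"
    by (auto intro!: differentiable_imp_continuous_on simp: differentiable_on_def)
qed

text \<open>The complement of the support is open and \<phi> is zero on all of it, hence so is its
  derivative.\<close>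

lemma test_function_eq_0:
  assumes "\<phi> \<in> test_functions U" "x \<notin> U"
  shows "\<phi> x = 0" "deriv \<phi> x = 0"
proof -
  let ?K = "closure {x. \<phi> x \<noteq> 0}"
  have K: "x \<notin> ?K"
    using assms by (auto simp: test_functions_def)
  have zero: "\<phi> y = 0" if "y \<notin> ?K" for y
    using that closure_subset[of "{x. \<phi> x \<noteq> 0}"] by auto
  then show "\<phi> x = 0"
    using K by blast
  have "(\<phi> has_real_derivative 0) (at x)"
  proof (rule has_field_derivative_transform_within_open[of "\<lambda>_. 0" _ _ "- ?K"])
    show "0 = \<phi> y" if "y \<in> - ?K" for y
      using zero[of y] that by simp
  qed (use K in \<open>simp_all add: open_Compl\<close>)
  then show "deriv \<phi> x = 0"
    by (rule DERIV_imp_deriv)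
qed

lemma test_functions_mono: "U \<subseteq> V \<Longrightarrow> test_functions U \<subseteq> test_functions V"
  by (auto simp: test_functions_def)

text \<open>Subtracting the slope reduces the claim to F = N - \<kappa> x having no increase. The
  derivative of a smoothed indicator of [t1, t2] is a bump at t1 minus an equal bump at t2, so
  pairing it with F nearly compares F(t1) with F(t2). An increase leaves a gap m1 < m2 that absorbs
  the smoothing error.\<close>

lemma distr_deriv_le_const_imp_increment_le:
  fixes N :: "real \<Rightarrow> real"
  assumes N: "continuous_on {\<alpha><..<\<beta>} N"
    and le: "\<And>\<phi>. \<phi> \<in> test_functions {\<alpha><..<\<beta>} \<Longrightarrow> (\<forall>x. 0 \<le> \<phi> x) \<Longrightarrow>
      - (LINT x:{\<alpha><..<\<beta>}|lebesgue. N x * deriv \<phi> x) \<le> \<kappa> * (LINT x:{\<alpha><..<\<beta>}|lebesgue. \<phi> x)"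
    and t: "\<alpha> < t1" "t1 < t2" "t2 < \<beta>"
  shows "N t2 - N t1 \<le> \<kappa> * (t2 - t1)"
proof (rule ccontr)
  define F where "F x = N x - \<kappa> * x" for x
  assume "\<not> ?thesis"
  then have "F t1 < F t2"
    by (simp add: F_def algebra_simps)
  then obtain m1 m2 where m: "F t1 < m1" "m1 < m2" "m2 < F t2"
    by (meson dense)
  have F: "isCont F x" if "x \<in> {\<alpha><..<\<beta>}" for x
    unfolding F_def using N that
    by (intro continuous_intros) (simp add: continuous_on_eq_continuous_at)
  have "eventually (\<lambda>x. F x < m1) (nhds t1)"
    using F[of t1] t m by (intro order_tendstoD(2)[of F "F t1"]) (auto simp: isCont_def continuous_at tendsto_at_iff_tendsto_nhds)
  then obtain d1 where d1: "0 < d1" "\<And>x. dist x t1 < d1 \<Longrightarrow> F x < m1"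
    by (auto simp: eventually_nhds_metric)
  have "eventually (\<lambda>x. m2 < F x) (nhds t2)"
    using F[of t2] t m by (intro order_tendstoD(1)[of F "F t2"]) (auto simp: isCont_def continuous_at tendsto_at_iff_tendsto_nhds)
  then obtain d2 where d2: "0 < d2" "\<And>x. dist x t2 < d2 \<Longrightarrow> m2 < F x"
    by (auto simp: eventually_nhds_metric)
  \<comment> \<open>The bumps of width \<epsilon> must stay where F < m1 and where m2 < F
    respectively, and the support must end before \<beta>.\<close>
  define \<epsilon> where "\<epsilon> = min (min d1 d2) (\<beta> - t2) / 2"
  have \<epsilon>: "0 < \<epsilon>" "\<epsilon> < d1" "\<epsilon> < d2" "t2 + \<epsilon> < \<beta>"
    using d1(1) d2(1) t by (auto simp: \<epsilon>_def min_def field_simps)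
  define S where "S = {t1..t2 + \<epsilon>}"
  define \<phi> where "\<phi> = (\<lambda>x. step \<epsilon> (x - t1) - step \<epsilon> (x - t2))"
  have S: "S \<subseteq> {\<alpha><..<\<beta>}"
    using t \<epsilon> by (auto simp: S_def)
  have D: "(\<phi> has_real_derivative bump \<epsilon> (x - t1) - bump \<epsilon> (x - t2)) (at x within A)" for x A
    unfolding \<phi>_def by (auto intro!: derivative_eq_intros)
  have d\<phi>: "deriv \<phi> = (\<lambda>x. bump \<epsilon> (x - t1) - bump \<epsilon> (x - t2))"
    by (auto intro!: DERIV_imp_deriv D)
  have cb: "continuous_on S (\<lambda>x. bump \<epsilon> (x - a))" for a
    by (rule continuous_on_compose2[OF continuous_on_bump[of UNIV]]) (auto intro!: continuous_intros)
  have c\<phi>: "continuous_on S \<phi>"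
    using D by (rule DERIV_continuous_on)
  have cN: "continuous_on S N"
    using N S continuous_on_subset by blast
  have cF: "continuous_on S F"
    unfolding F_def by (intro continuous_intros cN)
  have off: "deriv \<phi> x = 0" "\<phi> x = 0" if "x \<notin> S" for x
  proof -
    show "deriv \<phi> x = 0"
      using that t \<epsilon> by (auto simp: d\<phi> S_def bump_eq_0)
    show "\<phi> x = 0"
      using that t \<epsilon> step_eq_const[of \<epsilon> "x - t1"] step_eq_const[of \<epsilon> "x - t2"]
      by (cases "x < t1") (auto simp: \<phi>_def S_def step_eq_0)
  qed
  have restrict: "(LINT x:{\<alpha><..<\<beta>}|lebesgue. g x) = integral S g"
    if "continuous_on S g" "\<And>x. x \<notin> S \<Longrightarrow> g x = 0" for g :: "real \<Rightarrow> real"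
    using set_integral_eq_integral_of_support[of t1 "t2 + \<epsilon>" g "{\<alpha><..<\<beta>}", folded S_def] that S
    by blast
  have "\<phi> \<in> test_functions {\<alpha><..<\<beta>}"
    unfolding \<phi>_def using t \<epsilon> by (intro step_diff_test_function) auto
  moreover have "\<forall>x. 0 \<le> \<phi> x"
    using t by (auto simp: \<phi>_def intro: step_mono)
  ultimately have "- (LINT x:{\<alpha><..<\<beta>}|lebesgue. N x * deriv \<phi> x)
      \<le> \<kappa> * (LINT x:{\<alpha><..<\<beta>}|lebesgue. \<phi> x)"
    by (rule le)
  moreover have "(LINT x:{\<alpha><..<\<beta>}|lebesgue. N x * deriv \<phi> x) = integral S (\<lambda>x. N x * deriv \<phi> x)"
  proof (rule restrict)
    show "continuous_on S (\<lambda>x. N x * deriv \<phi> x)"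
      unfolding d\<phi> by (intro continuous_intros cb cN)
  qed (simp add: off)
  moreover have "(LINT x:{\<alpha><..<\<beta>}|lebesgue. \<phi> x) = integral S \<phi>"
    by (rule restrict[OF c\<phi> off(2)])
  ultimately have 1: "- integral S (\<lambda>x. N x * deriv \<phi> x) \<le> \<kappa> * integral S \<phi>"
    by simp
  \<comment> \<open>Integration by parts rewrites the integral of \<phi> as minus that of x \<phi>',
    so the term with \<kappa> merges with N into F.\<close>
  have "((\<lambda>x. \<phi> x + x * deriv \<phi> x) has_integral
      (t2 + \<epsilon>) * \<phi> (t2 + \<epsilon>) - t1 * \<phi> t1) S"
    unfolding S_def using t \<epsilon>
    by (intro fundamental_theorem_of_calculus)
      (auto simp: d\<phi> has_real_derivative_iff_has_vector_derivative[symmetric]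
        intro!: derivative_eq_intros D)
  moreover have "\<phi> t1 = 0" "\<phi> (t2 + \<epsilon>) = 0"
    using t \<epsilon> step_eq_const[of \<epsilon> "t2 + \<epsilon> - t1"] by (auto simp: \<phi>_def step_eq_0)
  ultimately have parts: "((\<lambda>x. \<phi> x + x * deriv \<phi> x) has_integral 0) S"
    by simp
  have "(\<lambda>x. x * deriv \<phi> x) integrable_on S" "(\<lambda>x. N x * deriv \<phi> x) integrable_on S"
    unfolding S_def d\<phi>
    by (intro integrable_continuous_interval continuous_intros cb[unfolded S_def] cN[unfolded S_def])+
  note int = integrable_integral[OF this(1)] integrable_integral[OF this(2)]
  have "integral S \<phi> = - integral S (\<lambda>x. x * deriv \<phi> x)"
    using has_integral_diff[OF parts int(1)] by (simp add: integral_unique)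
  moreover have "integral S (\<lambda>x. F x * deriv \<phi> x) =
      integral S (\<lambda>x. N x * deriv \<phi> x) - \<kappa> * integral S (\<lambda>x. x * deriv \<phi> x)"
    using has_integral_diff[OF int(2) has_integral_mult_right[OF int(1), of \<kappa>]]
    by (simp add: F_def left_diff_distrib mult.assoc integral_unique)
  ultimately have 2: "0 \<le> integral S (\<lambda>x. F x * deriv \<phi> x)"
    using 1 by simp
  \<comment> \<open>Both bumps carry the same mass, hence the upper bound below is (m1 - m2) times
    that mass.\<close>
  have Z: "((\<lambda>x. bump \<epsilon> (x - a)) has_integral step \<epsilon> \<epsilon>) S" if "a \<in> {t1, t2}" for a
  proof -
    have "((\<lambda>x. bump \<epsilon> (x - a)) has_integral step \<epsilon> (t2 + \<epsilon> - a) - step \<epsilon> (t1 - a)) S"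
      unfolding S_def using t \<epsilon>
      by (intro fundamental_theorem_of_calculus)
        (auto simp: has_real_derivative_iff_has_vector_derivative[symmetric] intro!: derivative_eq_intros)
    then show ?thesis
      using that t \<epsilon> step_eq_const[of \<epsilon> "t2 + \<epsilon> - a"] by (auto simp: step_eq_0)
  qed
  have "integral S (\<lambda>x. F x * deriv \<phi> x) \<le> integral S (\<lambda>x. m1 * bump \<epsilon> (x - t1) - m2 * bump \<epsilon> (x - t2))"
  proof (rule integral_le)
    show "(\<lambda>x. F x * deriv \<phi> x) integrable_on S"
      unfolding d\<phi> S_def by (intro integrable_continuous_interval continuous_intros cb[unfolded S_def] cF[unfolded S_def])
    show "(\<lambda>x. m1 * bump \<epsilon> (x - t1) - m2 * bump \<epsilon> (x - t2)) integrable_on S"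
      unfolding S_def by (intro integrable_continuous_interval continuous_intros cb[unfolded S_def])
    fix x assume "x \<in> S"
    have "F x * bump \<epsilon> (x - t1) \<le> m1 * bump \<epsilon> (x - t1)"
    proof (cases "t1 < x \<and> x < t1 + \<epsilon>")
      case True
      then show ?thesis
        using d1(2)[of x] \<epsilon> bump_nonneg by (intro mult_right_mono) (auto simp: dist_real_def)
    qed (auto simp: bump_eq_0)
    moreover have "m2 * bump \<epsilon> (x - t2) \<le> F x * bump \<epsilon> (x - t2)"
    proof (cases "t2 < x \<and> x < t2 + \<epsilon>")
      case True
      then show ?thesis
        using d2(2)[of x] \<epsilon> bump_nonneg by (intro mult_right_mono) (auto simp: dist_real_def)
    qed (auto simp: bump_eq_0)
    ultimately show "F x * deriv \<phi> x \<le> m1 * bump \<epsilon> (x - t1) - m2 * bump \<epsilon> (x - t2)"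
      by (simp add: d\<phi> right_diff_distrib)
  qed
  also have "\<dots> = (m1 - m2) * step \<epsilon> \<epsilon>"
    using has_integral_diff[OF has_integral_mult_right[OF Z[of t1], of m1] has_integral_mult_right[OF Z[of t2], of m2]]
    by (simp add: integral_unique left_diff_distrib)
  also have "\<dots> < 0"
    using m step_pos[OF \<epsilon>(1)] by (simp add: mult_neg_pos)
  finally show False
    using 2 by simp
qed

section \<open>Convolution with the singular kernel\<close>

text \<open>Extension by zero turns one-sided fractional integrals into integrals over the whole
  line, to which reflection, translation and Fubini apply directly.\<close>

definition pker :: "real \<Rightarrow> real \<Rightarrow> real" where
  "pker \<alpha> x = (if 0 < x then x powr (- \<alpha>) else 0)"

text \<open>For y vanishing on the negative axis this is \<Gamma>(1 - \<alpha>) times the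
  Riemann-Liouville integral of order 1 - \<alpha>.\<close>

definition conv :: "real \<Rightarrow> (real \<Rightarrow> real) \<Rightarrow> real \<Rightarrow> real" where
  "conv \<alpha> y t = (LINT s|lborel. pker \<alpha> (t - s) * y s)"

lemma pker_nonneg: "0 \<le> pker \<alpha> x"
  by (simp add: pker_def)

lemma pker_measurable [measurable]: "pker \<alpha> \<in> borel_measurable borel"
  unfolding pker_def by measurable

lemma pker_antimono: "0 \<le> \<alpha> \<Longrightarrow> 0 < x \<Longrightarrow> x \<le> y \<Longrightarrow> pker \<alpha> y \<le> pker \<alpha> x"
  by (simp add: pker_def powr_mono2')

lemma nn_integral_pker:
  assumes "\<alpha> < 1" "a \<le> t"
  shows "(\<integral>\<^sup>+s. ennreal (pker \<alpha> (t - s)) * indicator {a..} s \<partial>lborel)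
    = ennreal ((t - a) powr (1 - \<alpha>) / (1 - \<alpha>))"
proof -
  have "(\<integral>\<^sup>+s. ennreal (pker \<alpha> (t - s)) * indicator {a..} s \<partial>lborel)
      = (\<integral>\<^sup>+x. ennreal (pker \<alpha> x) * indicator {..t - a} x \<partial>lborel)"
    by (subst nn_integral_real_affine[where c = "-1" and t = t])
      (auto intro!: nn_integral_cong simp: indicator_def)
  \<comment> \<open>The integrands agree at x = 0 as well, because
    \<open>0 powr (- \<alpha>)\<close> is 0.\<close>
  also have "\<dots> = (\<integral>\<^sup>+x. ennreal (x powr (- \<alpha>)) * indicator {0..t - a} x \<partial>lborel)"
    by (intro nn_integral_cong) (auto simp: pker_def indicator_def)
  also have "\<dots> = ennreal ((t - a) powr (- \<alpha> + 1) / (- \<alpha> + 1))"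
    using nn_integral_has_integral_lebesgue'[OF _ has_integral_powr_from_0[of "- \<alpha>" "t - a"]] assms
    by simp
  finally show ?thesis
    by simp
qed

lemma integrable_pker_indicator:
  assumes "\<alpha> < 1"
  shows "integrable lborel (\<lambda>s. pker \<alpha> (t - s) * indicator {a..} s)"
proof (cases "a \<le> t")
  case True
  then show ?thesis
    using nn_integral_pker[OF assms True]
    by (intro integrableI_nonneg)
      (auto simp: pker_nonneg ennreal_mult' ennreal_indicator)
next
  case False
  then have "(\<lambda>s. pker \<alpha> (t - s) * indicator {a..} s) = (\<lambda>s. 0 :: real)"
    by (auto simp: pker_def indicator_def)
  then show ?thesis
    by simp
qed

lemma conv_indicator:
  assumes "\<alpha> < 1" "a \<le> t"
  shows "conv \<alpha> (indicator {a..}) t = (t - a) powr (1 - \<alpha>) / (1 - \<alpha>)"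
  unfolding conv_def using nn_integral_pker[OF assms] assms
  by (subst integral_eq_nn_integral)
    (auto simp: pker_nonneg ennreal_mult' ennreal_indicator)

lemma integrable_pker_mult:
  assumes "\<alpha> < 1" "y \<in> borel_measurable borel" "\<And>s. \<bar>y s\<bar> \<le> C" "\<And>s. s < a \<Longrightarrow> y s = 0"
  shows "integrable lborel (\<lambda>s. pker \<alpha> (t - s) * y s)"
proof (rule Bochner_Integration.integrable_bound)
  show "integrable lborel (\<lambda>s. C * (pker \<alpha> (t - s) * indicator {a..} s))"
    using integrable_pker_indicator[OF assms(1)] by simp
  have "0 \<le> C"
    using assms(3)[of 0] by linarith
  then show "AE s in lborel. norm (pker \<alpha> (t - s) * y s) \<le> norm (C * (pker \<alpha> (t - s) * indicator {a..} s))"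
    using assms(3) assms(4)
    by (auto simp: indicator_def abs_mult pker_nonneg mult.commute[of C] intro!: mult_left_mono AE_I2)
qed (use assms(2) in measurable)

text \<open>The increment splits into the change of the kernel on the history up to t' and the
  contribution of [t', t]. Both have explicit majorants, since the kernel integrates to a
  power.\<close>

lemma conv_Hoelder:
  assumes "0 < \<alpha>" "\<alpha> < 1" "y \<in> borel_measurable borel" "\<And>s. \<bar>y s\<bar> \<le> C" "\<And>s. s < a \<Longrightarrow> y s = 0"
    and t: "a \<le> t'" "t' < t"
  shows "\<bar>conv \<alpha> y t - conv \<alpha> y t'\<bar> \<le> 2 * C / (1 - \<alpha>) * (t - t') powr (1 - \<alpha>)"
proof -
  note int = integrable_pker_mult[OF assms(2-5)] integrable_pker_indicator[OF assms(2)]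
  have "0 \<le> C"
    using assms(4)[of 0] by linarith
  \<comment> \<open>For s < t' the kernel decreases in time, so the first difference is its own
    absolute value. For t' <= s its first term vanishes, and adding the recent part twice turns the
    remaining minus sign into a plus.\<close>
  let ?m = "\<lambda>s. C * (pker \<alpha> (t' - s) * indicator {a..} s - pker \<alpha> (t - s) * indicator {a..} s
      + 2 * (pker \<alpha> (t - s) * indicator {t'..} s))"
  have pt: "\<bar>pker \<alpha> (t - s) * y s - pker \<alpha> (t' - s) * y s\<bar> \<le> ?m s" for s
  proof (cases "a \<le> s")
    case True
    have "\<bar>pker \<alpha> (t - s) * y s - pker \<alpha> (t' - s) * y s\<bar> = \<bar>pker \<alpha> (t - s) - pker \<alpha> (t' - s)\<bar> * \<bar>y s\<bar>"
      by (simp add: abs_mult[symmetric] left_diff_distrib)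
    also have "\<dots> \<le> \<bar>pker \<alpha> (t - s) - pker \<alpha> (t' - s)\<bar> * C"
      by (intro mult_left_mono assms) auto
    also have "\<bar>pker \<alpha> (t - s) - pker \<alpha> (t' - s)\<bar>
        \<le> pker \<alpha> (t' - s) - pker \<alpha> (t - s) + 2 * (pker \<alpha> (t - s) * indicator {t'..} s)"
      using pker_antimono[of \<alpha> "t' - s" "t - s"] assms pker_nonneg[of \<alpha> "t - s"]
      by (cases "t' \<le> s") (auto simp: indicator_def pker_def)
    finally show ?thesis
      using True \<open>0 \<le> C\<close> by (simp add: mult.commute mult_right_mono)
  qed (use assms t in \<open>auto simp: indicator_def\<close>)
  have "\<bar>conv \<alpha> y t - conv \<alpha> y t'\<bar> = \<bar>LINT s|lborel. pker \<alpha> (t - s) * y s - pker \<alpha> (t' - s) * y s\<bar>"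
    unfolding conv_def using int by (subst Bochner_Integration.integral_diff) auto
  also have "\<dots> \<le> (LINT s|lborel. \<bar>pker \<alpha> (t - s) * y s - pker \<alpha> (t' - s) * y s\<bar>)"
    by (rule integral_abs_bound)
  also have "\<dots> \<le> (LINT s|lborel. ?m s)"
    using int pt by (intro integral_mono) auto
  also have "\<dots> = C * (conv \<alpha> (indicator {a..}) t' - conv \<alpha> (indicator {a..}) t + 2 * conv \<alpha> (indicator {t'..}) t)"
    unfolding conv_def using int by simp
  also have "\<dots> = C * ((t' - a) powr (1 - \<alpha>) / (1 - \<alpha>) - (t - a) powr (1 - \<alpha>) / (1 - \<alpha>)
      + 2 * ((t - t') powr (1 - \<alpha>) / (1 - \<alpha>)))"
    using assms by (simp add: conv_indicator)
  \<comment> \<open>The history terms have a nonpositive difference, since t' - a < t - a, and are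
    dropped.\<close>
  also have "\<dots> \<le> C * (2 * ((t - t') powr (1 - \<alpha>) / (1 - \<alpha>)))"
    using assms \<open>0 \<le> C\<close> by (intro mult_left_mono) (auto intro!: divide_right_mono powr_mono2)
  finally show ?thesis
    by (simp add: mult_ac)
qed

lemma continuous_on_conv:
  assumes "0 < \<alpha>" "\<alpha> < 1" "y \<in> borel_measurable borel" "\<And>s. \<bar>y s\<bar> \<le> C" "\<And>s. s < a \<Longrightarrow> y s = 0"
  shows "continuous_on {a..} (conv \<alpha> y)"
  unfolding continuous_on_def
proof
  fix x assume x: "x \<in> {a..}"
  have "\<bar>conv \<alpha> y z - conv \<alpha> y x\<bar> \<le> 2 * C / (1 - \<alpha>) * \<bar>z - x\<bar> powr (1 - \<alpha>)" if "z \<in> {a..}" for z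
    using conv_Hoelder[OF assms, of a z x] conv_Hoelder[OF assms, of a x z] x that
    by (cases z x rule: linorder_cases) (auto simp: abs_minus_commute)
  then have "eventually (\<lambda>z. norm (conv \<alpha> y z - conv \<alpha> y x) \<le> 2 * C / (1 - \<alpha>) * \<bar>z - x\<bar> powr (1 - \<alpha>))
      (at x within {a..})"
    unfolding eventually_at_filter by simp
  moreover have "((\<lambda>z. 2 * C / (1 - \<alpha>) * \<bar>z - x\<bar> powr (1 - \<alpha>)) \<longlongrightarrow> 2 * C / (1 - \<alpha>) * 0)
      (at x within {a..})"
    by (intro tendsto_mult tendsto_const tendsto_zero_powrI[where b = "1 - \<alpha>"] tendsto_rabs_zero
        LIM_zero tendsto_ident_at) (use assms in auto)
  ultimately have "((\<lambda>z. conv \<alpha> y z - conv \<alpha> y x) \<longlongrightarrow> 0) (at x within {a..})"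
    by (simp add: Lim_null_comparison)
  then show "(conv \<alpha> y \<longlongrightarrow> conv \<alpha> y x) (at x within {a..})"
    by (rule LIM_zero_cancel)
qed

section \<open>The Beta integral and Abel inversion\<close>

lemma nn_integral_pker_pker:
  assumes "0 < \<gamma>" "\<gamma> < 1" "s < t"
  shows "(\<integral>\<^sup>+r. ennreal (pker (1 - \<gamma>) (t - r)) * ennreal (pker \<gamma> (r - s)) \<partial>lborel)
    = ennreal (Beta (1 - \<gamma>) \<gamma>)"
proof -
  have "(\<integral>\<^sup>+r. ennreal (pker (1 - \<gamma>) (t - r)) * ennreal (pker \<gamma> (r - s)) \<partial>lborel)
      = ennreal (t - s) * (\<integral>\<^sup>+x. ennreal (pker (1 - \<gamma>) (t - (s + (t - s) * x)))
          * ennreal (pker \<gamma> (s + (t - s) * x - s)) \<partial>lborel)"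
    using assms by (subst nn_integral_real_affine[where c = "t - s" and t = s]) auto
  also have "\<dots> = (\<integral>\<^sup>+x. ennreal (t - s) * (ennreal (pker (1 - \<gamma>) (t - (s + (t - s) * x)))
          * ennreal (pker \<gamma> (s + (t - s) * x - s))) \<partial>lborel)"
    by (subst nn_integral_cmult) auto
  also have "\<dots> = (\<integral>\<^sup>+x. ennreal (x powr ((1 - \<gamma>) - 1) * (1 - x) powr (\<gamma> - 1)) * indicator {0..1} x \<partial>lborel)"
  proof (intro nn_integral_cong)
    fix x :: real
    have *: "t - (s + (t - s) * x) = (t - s) * (1 - x)"
      by (simp add: algebra_simps)
    show "ennreal (t - s) * (ennreal (pker (1 - \<gamma>) (t - (s + (t - s) * x)))
          * ennreal (pker \<gamma> (s + (t - s) * x - s)))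
        = ennreal (x powr ((1 - \<gamma>) - 1) * (1 - x) powr (\<gamma> - 1)) * indicator {0..1} x"
    proof (cases "0 < x \<and> x < 1")
      case True
      \<comment> \<open>The Jacobian and the two kernels contribute the exponents 1, \<gamma> - 1
        and -\<gamma>, whose sum is 0. The result is therefore independent of s and t, which is what
        makes Abel inversion work.\<close>
      have "(t - s) * (((t - s) * (1 - x)) powr (\<gamma> - 1) * ((t - s) * x) powr (- \<gamma>))
          = ((t - s) powr 1 * (t - s) powr (\<gamma> - 1) * (t - s) powr (- \<gamma>))
            * (x powr (- \<gamma>) * (1 - x) powr (\<gamma> - 1))"
        using True assms by (simp add: powr_mult)
      also have "(t - s) powr 1 * (t - s) powr (\<gamma> - 1) * (t - s) powr (- \<gamma>) = 1"
        unfolding powr_add[symmetric] using assms by simp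
      finally show ?thesis
        using True assms unfolding *
        by (simp add: pker_def ennreal_mult'[symmetric])
    next
      case False
      \<comment> \<open>At x = 0 and x = 1 both sides vanish, because a zero base makes
        \<open>powr\<close> zero.\<close>
      then consider "x < 0" | "x = 0" | "x = 1" | "1 < x"
        by linarith
      then show ?thesis
        using assms unfolding * by cases (auto simp: pker_def zero_less_mult_iff)
    qed
  qed
  also have "\<dots> = ennreal (Beta (1 - \<gamma>) \<gamma>)"
    using assms by (intro nn_integral_has_integral_lebesgue' has_integral_Beta_real) auto
  finally show ?thesis .
qed

text \<open>
  Abel inversion: convolution with the kernel of exponent \<open>1 - \<gamma>\<close> turns the fractional integral with
  exponent \<open>\<gamma>\<close> into a plain integral.
\<close>

lemma nn_integral_Abel:
  assumes "0 < \<gamma>" "\<gamma> < 1" and [measurable]: "q \<in> borel_measurable borel"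
  shows "(\<integral>\<^sup>+r. ennreal (pker (1 - \<gamma>) (t - r)) * (\<integral>\<^sup>+s. ennreal (pker \<gamma> (r - s)) * q s \<partial>lborel) \<partial>lborel)
    = ennreal (Beta (1 - \<gamma>) \<gamma>) * (\<integral>\<^sup>+s. q s * indicator {..<t} s \<partial>lborel)"
proof -
  have "(\<integral>\<^sup>+r. ennreal (pker (1 - \<gamma>) (t - r)) * (\<integral>\<^sup>+s. ennreal (pker \<gamma> (r - s)) * q s \<partial>lborel) \<partial>lborel)
      = (\<integral>\<^sup>+r. (\<integral>\<^sup>+s. ennreal (pker (1 - \<gamma>) (t - r)) * (ennreal (pker \<gamma> (r - s)) * q s) \<partial>lborel) \<partial>lborel)"
    by (intro nn_integral_cong nn_integral_cmult[symmetric]) measurable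
  also have "\<dots> = (\<integral>\<^sup>+s. (\<integral>\<^sup>+r. ennreal (pker (1 - \<gamma>) (t - r)) * (ennreal (pker \<gamma> (r - s)) * q s) \<partial>lborel) \<partial>lborel)"
    by (rule lborel_pair.Fubini'[symmetric]) measurable
  also have "\<dots> = (\<integral>\<^sup>+s. (\<integral>\<^sup>+r. ennreal (pker (1 - \<gamma>) (t - r)) * ennreal (pker \<gamma> (r - s)) \<partial>lborel) * q s \<partial>lborel)"
    by (subst nn_integral_multc[symmetric]) (auto simp: mult.assoc)
  also have "\<dots> = (\<integral>\<^sup>+s. ennreal (Beta (1 - \<gamma>) \<gamma>) * (q s * indicator {..<t} s) \<partial>lborel)"
  proof (intro nn_integral_cong)
    fix s :: real
    show "(\<integral>\<^sup>+r. ennreal (pker (1 - \<gamma>) (t - r)) * ennreal (pker \<gamma> (r - s)) \<partial>lborel) * q s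
        = ennreal (Beta (1 - \<gamma>) \<gamma>) * (q s * indicator {..<t} s)"
    proof (cases "s < t")
      case True
      then show ?thesis
        using nn_integral_pker_pker[OF assms(1,2) True] by simp
    next
      case False
      \<comment> \<open>No r lies strictly between s and t, so one of the two kernels is always
        zero.\<close>
      then have "(\<lambda>r. ennreal (pker (1 - \<gamma>) (t - r)) * ennreal (pker \<gamma> (r - s))) = (\<lambda>r. 0)"
        by (auto simp: pker_def)
      then show ?thesis
        using False by simp
    qed
  qed
  also have "\<dots> = ennreal (Beta (1 - \<gamma>) \<gamma>) * (\<integral>\<^sup>+s. q s * indicator {..<t} s \<partial>lborel)"
    by (rule nn_integral_cmult) measurable
  finally show ?thesis .
qed

text \<open>Abel inversion at t and at t - \<eta> expresses the mass of q on the last stretch of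
  length \<eta> through the increments M(r + \<eta>) - M(r) of its fractional integral. Each is at
  least \<delta> \<eta> for a < r < t - \<eta>, and integrating the inverse kernel over that range
  gives the power of t - \<eta> - a.\<close>

lemma Abel_increment_lower_bound:
  assumes \<gamma>: "0 < \<gamma>" "\<gamma> < 1" and [measurable]: "q \<in> borel_measurable borel"
    and q0: "\<And>s. s \<le> a \<Longrightarrow> q s = 0"
    and fin: "(\<integral>\<^sup>+s. q s * indicator {..<t} s \<partial>lborel) < \<infinity>"
    and inc: "\<And>r1 r2. a < r1 \<Longrightarrow> r1 < r2 \<Longrightarrow> r2 < t \<Longrightarrow>
      (\<integral>\<^sup>+s. ennreal (pker \<gamma> (r1 - s)) * q s \<partial>lborel) + ennreal (\<delta> * (r2 - r1))
        \<le> (\<integral>\<^sup>+s. ennreal (pker \<gamma> (r2 - s)) * q s \<partial>lborel)"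
    and \<eta>: "0 < \<eta>" "\<eta> < t - a" and "0 \<le> \<delta>"
  shows "ennreal (\<delta> * \<eta> * ((t - \<eta> - a) powr \<gamma> / \<gamma>))
    \<le> ennreal (Beta (1 - \<gamma>) \<gamma>) * (\<integral>\<^sup>+s. q s * indicator {t - \<eta>..<t} s \<partial>lborel)"
proof -
  define M where "M r = (\<integral>\<^sup>+s. ennreal (pker \<gamma> (r - s)) * q s \<partial>lborel)" for r
  define Q where "Q t = (\<integral>\<^sup>+s. q s * indicator {..<t} s \<partial>lborel)" for t
  have [measurable]: "M \<in> borel_measurable borel"
    unfolding M_def by measurable
  have M0: "M r = 0" if "r \<le> a" for r
  proof -
    have "ennreal (pker \<gamma> (r - s)) * q s = 0" for s
      using q0[of s] that by (cases "s \<le> a") (auto simp: pker_def)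
    then show ?thesis
      unfolding M_def by (subst nn_integral_cong[where v = "\<lambda>_. 0"]) auto
  qed
  let ?k = "\<lambda>r. ennreal (pker (1 - \<gamma>) (t - \<eta> - r))"
  have "ennreal (Beta (1 - \<gamma>) \<gamma>) * Q (t - \<eta>) + ennreal (\<delta> * \<eta>) * ennreal ((t - \<eta> - a) powr \<gamma> / \<gamma>)
      = (\<integral>\<^sup>+r. ?k r * M r \<partial>lborel) + ennreal (\<delta> * \<eta>) * (\<integral>\<^sup>+r. ?k r * indicator {a..} r \<partial>lborel)"
    using nn_integral_Abel[OF \<gamma> assms(3), of "t - \<eta>"] nn_integral_pker[of "1 - \<gamma>" a "t - \<eta>"] \<gamma> \<eta>
    by (simp add: M_def Q_def)
  also have "\<dots> = (\<integral>\<^sup>+r. ?k r * M r + ennreal (\<delta> * \<eta>) * (?k r * indicator {a..} r) \<partial>lborel)"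
    by (subst nn_integral_add) (auto simp: nn_integral_cmult)
  also have "\<dots> \<le> (\<integral>\<^sup>+r. ?k r * M (r + \<eta>) \<partial>lborel)"
  proof (rule nn_integral_mono_AE)
    show "AE r in lborel. ?k r * M r + ennreal (\<delta> * \<eta>) * (?k r * indicator {a..} r) \<le> ?k r * M (r + \<eta>)"
      \<comment> \<open>The growth hypothesis starts strictly after a, so the point r = a is
        discarded. Left of a the left side is zero, and from t - \<eta> on the kernel is.\<close>
      using AE_lborel_singleton[of a]
    proof eventually_elim
      case (elim r)
      consider "r < a" | "a < r" "r < t - \<eta>" | "t - \<eta> \<le> r"
        using elim by linarith
      then show ?case
      proof cases
        case 2
        then have "M r + ennreal (\<delta> * \<eta>) \<le> M (r + \<eta>)"
          using inc[of r "r + \<eta>"] \<eta> by (simp add: M_def)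
        then have "?k r * (M r + ennreal (\<delta> * \<eta>)) \<le> ?k r * M (r + \<eta>)"
          by (intro mult_left_mono) auto
        then show ?thesis
          using 2 by (simp add: distrib_right mult.commute)
      qed (auto simp: M0 pker_def)
    qed
  qed
  \<comment> \<open>Translation by \<eta> moves the shift from \<open>M\<close> into the kernel,
    which gives Abel inversion at t.\<close>
  also have "\<dots> = (\<integral>\<^sup>+r. ennreal (pker (1 - \<gamma>) (t - r)) * M r \<partial>lborel)"
    by (subst (2) nn_integral_real_affine[where c = 1 and t = \<eta>]) (auto simp: algebra_simps)
  also have "\<dots> = ennreal (Beta (1 - \<gamma>) \<gamma>) * Q t"
    using nn_integral_Abel[OF \<gamma> assms(3), of t] by (simp add: M_def Q_def)
  also have "Q t = (\<integral>\<^sup>+s. q s * indicator {..<t - \<eta>} s + q s * indicator {t - \<eta>..<t} s \<partial>lborel)"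
    unfolding Q_def using \<eta> by (intro nn_integral_cong) (auto simp: indicator_def)
  also have "\<dots> = Q (t - \<eta>) + (\<integral>\<^sup>+s. q s * indicator {t - \<eta>..<t} s \<partial>lborel)"
    unfolding Q_def by (rule nn_integral_add) measurable
  finally have *: "ennreal (Beta (1 - \<gamma>) \<gamma>) * Q (t - \<eta>) + ennreal (\<delta> * \<eta> * ((t - \<eta> - a) powr \<gamma> / \<gamma>))
      \<le> ennreal (Beta (1 - \<gamma>) \<gamma>) * Q (t - \<eta>)
        + ennreal (Beta (1 - \<gamma>) \<gamma>) * (\<integral>\<^sup>+s. q s * indicator {t - \<eta>..<t} s \<partial>lborel)"
    using \<eta> \<open>0 \<le> \<delta>\<close> by (simp add: distrib_left ennreal_mult'[symmetric])
  \<comment> \<open>Cancelling the common term in the extended nonnegative reals requires its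
    finiteness.\<close>
  have "Q (t - \<eta>) \<le> Q t"
    unfolding Q_def using \<eta> by (intro nn_integral_mono) (auto simp: indicator_def)
  then have "Q (t - \<eta>) \<noteq> top"
    using fin by (auto simp: Q_def top_unique)
  then have "ennreal (Beta (1 - \<gamma>) \<gamma>) * Q (t - \<eta>) \<noteq> top"
    by (simp add: ennreal_mult_eq_top_iff)
  with * show ?thesis
    by (simp add: ennreal_add_left_cancel_le)
qed

text \<open>By the mean value theorem: the derivative \<open>z powr (- \<gamma>)\<close> decreases
  in z. Through \<open>conv_indicator\<close> this bounds the growth of the fractional integral of a
  unit step.\<close>

lemma powr_increment_lower_bound:
  fixes x y \<rho> \<gamma> :: real
  assumes "0 < \<gamma>" "\<gamma> < 1" "0 < x" "x < y" "y \<le> \<rho>"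
  shows "\<rho> powr (- \<gamma>) * (y - x) \<le> y powr (1 - \<gamma>) / (1 - \<gamma>) - x powr (1 - \<gamma>) / (1 - \<gamma>)"
proof -
  have "((\<lambda>x. x powr (1 - \<gamma>) / (1 - \<gamma>)) has_real_derivative z powr (- \<gamma>)) (at z)" if "0 < z" for z
    using that assms by (auto intro!: derivative_eq_intros)
  then obtain z where z: "x < z" "z < y"
    "y powr (1 - \<gamma>) / (1 - \<gamma>) - x powr (1 - \<gamma>) / (1 - \<gamma>) = (y - x) * z powr (- \<gamma>)"
    using MVT2[of x y "\<lambda>x. x powr (1 - \<gamma>) / (1 - \<gamma>)" "\<lambda>z. z powr (- \<gamma>)"] assms by fastforce
  have "\<rho> powr (- \<gamma>) \<le> z powr (- \<gamma>)"
    using z assms by (intro powr_mono2') auto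
  then show ?thesis
    using z assms by (simp add: mult.commute)
qed

section \<open>The maximum principle\<close>

text \<open>In the application c is minus the initial value of w, so w + c is the difference of two
  functions with their initial values subtracted. \<open>H\<close> is the differential inequality in
  integrated form, on intervals where 0 < w <= \<epsilon>. As c >= 0, the shift contributes a
  nondecreasing convolution.\<close>

lemma fractional_maximum_principle:
  fixes w :: "real \<Rightarrow> real"
  assumes \<gamma>: "0 < \<gamma>" "\<gamma> < 1"
    and cont: "continuous_on UNIV w" and bound: "\<And>s. \<bar>w s\<bar> \<le> C"
    and "w 0 \<le> 0" "0 \<le> c" "0 \<le> A"
    and H: "\<And>\<alpha> \<beta> \<epsilon> t1 t2. \<lbrakk>0 < \<alpha>; \<beta> < b; \<And>t. t \<in> {\<alpha><..<\<beta>} \<Longrightarrow> 0 < w t \<and> w t \<le> \<epsilon>;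
        \<alpha> < t1; t1 < t2; t2 < \<beta>\<rbrakk> \<Longrightarrow>
      conv \<gamma> (\<lambda>s. indicator {0..} s * (w s + c)) t2 - conv \<gamma> (\<lambda>s. indicator {0..} s * (w s + c)) t1
        \<le> A * \<epsilon> * (t2 - t1)"
    and t: "0 \<le> t" "t < b"
  shows "w t \<le> 0"
proof (rule ccontr)
  assume "\<not> w t \<le> 0"
  have w_near: "\<exists>d>0. \<forall>y. \<bar>y - x\<bar> < d \<longrightarrow> w y \<in> S" if "open S" "w x \<in> S" for x S
  proof -
    have "eventually (\<lambda>y. w y \<in> S) (nhds x)"
      using cont that
      by (intro topological_tendstoD[of w "w x"])
        (auto simp: continuous_on_eq_continuous_at isCont_def tendsto_at_iff_tendsto_nhds)
    then show ?thesis
      by (auto simp: eventually_nhds_metric dist_real_def)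
  qed
  have [measurable]: "w \<in> borel_measurable borel"
    using cont by (rule borel_measurable_continuous_onI)
  define Z where "Z = {s \<in> {0..t}. 0 < w s}"
  define \<tau> where "\<tau> = Inf Z"
  have Z: "t \<in> Z" "bdd_below Z"
    using t \<open>\<not> w t \<le> 0\<close> by (auto simp: Z_def intro: bdd_belowI[of _ 0])
  have \<tau>: "0 \<le> \<tau>" "\<tau> \<le> t"
    using Z unfolding \<tau>_def by (auto intro!: cInf_greatest cInf_lower simp: Z_def)
  have below: "w s \<le> 0" if "0 \<le> s" "s < \<tau>" for s
  proof (rule ccontr)
    assume "\<not> w s \<le> 0"
    then have "s \<in> Z"
      using that \<tau> by (auto simp: Z_def)
    then show False
      using cInf_lower[of s Z] Z that by (auto simp: \<tau>_def)
  qed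
  \<comment> \<open>A positive value at \<tau> > 0 would persist slightly to the left, against
    \<open>below\<close>; for \<tau> = 0 the initial condition decides.\<close>
  have "w \<tau> \<le> 0"
  proof (rule ccontr)
    assume "\<not> w \<tau> \<le> 0"
    then have "0 < \<tau>"
      using \<tau> \<open>w 0 \<le> 0\<close> by (cases "\<tau> = 0") auto
    obtain d where "0 < d" "\<And>y. \<bar>y - \<tau>\<bar> < d \<Longrightarrow> 0 < w y"
      using w_near[of "{0<..}" \<tau>] \<open>\<not> w \<tau> \<le> 0\<close> by auto
    then show False
      using below[of "max 0 (\<tau> - d / 2)"] \<open>0 < \<tau>\<close>
      by (smt (verit) field_sum_of_halves)
  qed
  \<comment> \<open>With this \<open>\<rho>\<close>, the kernel is at least \<open>A + 1\<close> on \<open>(0, \<rho>]\<close>, which beats the constant \<open>A\<close> in \<open>H\<close>.\<close>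
  define \<rho> where "\<rho> = (A + 1) powr (- (1 / \<gamma>))"
  have \<rho>: "0 < \<rho>" "\<rho> powr (- \<gamma>) = A + 1"
    using \<gamma> \<open>0 \<le> A\<close> by (auto simp: \<rho>_def powr_powr)
  obtain s where s: "s \<in> Z" "s < \<tau> + \<rho>"
    using cInf_lessD[of Z "\<tau> + \<rho>"] Z \<rho> by (auto simp: \<tau>_def)
  \<comment> \<open>The cap \<tau> + \<rho> keeps the maximum point within \<rho> of \<tau>; the cap
    t keeps it before b. Since s lies in [0, b'], the maximum is positive.\<close>
  define b' where "b' = min (\<tau> + \<rho>) t"
  have "0 \<le> b'"
    using \<tau> \<rho> by (simp add: b'_def)
  then have "\<exists>x\<in>{0..b'}. \<forall>y\<in>{0..b'}. w y \<le> w x"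
    using cont by (intro continuous_attains_sup) (auto intro: continuous_on_subset)
  then obtain t0 where t0: "t0 \<in> {0..b'}" "\<And>x. x \<in> {0..b'} \<Longrightarrow> w x \<le> w t0"
    by blast
  define \<epsilon> where "\<epsilon> = w t0"
  have "w s \<le> \<epsilon>"
    using s t0(2)[of s] by (auto simp: \<epsilon>_def Z_def b'_def)
  then have "0 < \<epsilon>"
    using s by (auto simp: Z_def)
  have "\<tau> < t0"
    using below[of t0] \<open>w \<tau> \<le> 0\<close> \<open>0 < \<epsilon>\<close> t0 \<tau> by (cases t0 \<tau> rule: linorder_cases) (auto simp: \<epsilon>_def)
  have t0b: "t0 \<le> \<tau> + \<rho>" "t0 < b"
    using t0 t by (auto simp: b'_def)
  obtain d where d: "0 < d" "\<And>y. \<bar>y - t0\<bar> < d \<Longrightarrow> 0 < w y"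
    using w_near[of "{0<..}" t0] \<open>0 < \<epsilon>\<close> by (auto simp: \<epsilon>_def)
  \<comment> \<open>The midpoint keeps t1 beyond \<tau>, and t0 - d/2 keeps w positive between t1
    and t0.\<close>
  define t1 where "t1 = max ((\<tau> + t0) / 2) (t0 - d / 2)"
  have t1_ge: "(\<tau> + t0) / 2 \<le> t1" "t0 - d / 2 \<le> t1"
    by (simp_all add: t1_def)
  have "\<tau> < t1"
    using t1_ge(1) \<open>\<tau> < t0\<close> by (simp add: field_simps)
  moreover have "t1 < t0"
    using \<open>\<tau> < t0\<close> d by (simp add: t1_def)
  ultimately have t1: "\<tau> < t1" "t1 < t0" "0 < t1"
    using \<tau> by auto
  have pos: "0 < w x \<and> w x \<le> \<epsilon>" if "x \<in> {t1<..<t0}" for x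
  proof -
    have "\<bar>x - t0\<bar> < d" "x \<in> {0..b'}"
      using that t1_ge(2) t1 t0(1) d(1) by (auto simp: field_simps)
    then show ?thesis
      using d(2) t0(2) by (simp add: \<epsilon>_def)
  qed
  \<comment> \<open>The cut-off at 0 makes q nonnegative everywhere, and q = \<epsilon> - w on (t1,
    t0). \<open>y1\<close> is the history up to t1, lowered by \<epsilon> from \<tau> on, and
    \<open>y\<close> is the function that \<open>H\<close> controls.\<close>
  define q where "q = (\<lambda>s. indicator {t1<..} s * max 0 (\<epsilon> - w s))"
  define y1 where "y1 = (\<lambda>s. indicator {0..t1} s * (w s - \<epsilon> * indicator {\<tau>..} s))"
  define y where "y = (\<lambda>s. indicator {0..} s * (w s + c))"
  have "0 \<le> C"
    using bound[of 0] by linarith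
  have int: "integrable lborel (\<lambda>s. pker \<gamma> (r - s) * q s)"
    "integrable lborel (\<lambda>s. pker \<gamma> (r - s) * y1 s)"
    "integrable lborel (\<lambda>s. pker \<gamma> (r - s) * y s)"
    "integrable lborel (\<lambda>s. pker \<gamma> (r - s) * indicator {\<tau>..} s)"
    "integrable lborel (\<lambda>s. pker \<gamma> (r - s) * indicator {0..} s)" for r
  proof -
    have "\<bar>q s\<bar> \<le> \<epsilon> + C" for s
      using bound[of s] \<open>0 < \<epsilon>\<close> \<open>0 \<le> C\<close> by (auto simp: q_def indicator_def)
    then show "integrable lborel (\<lambda>s. pker \<gamma> (r - s) * q s)"
      using \<gamma> t1 by (intro integrable_pker_mult[where a = 0]) (auto simp: q_def)
    have "\<bar>y1 s\<bar> \<le> \<epsilon> + C" for s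
      using bound[of s] \<open>0 < \<epsilon>\<close> \<open>0 \<le> C\<close> by (auto simp: y1_def indicator_def)
    then show "integrable lborel (\<lambda>s. pker \<gamma> (r - s) * y1 s)"
      using \<gamma> by (intro integrable_pker_mult[where a = 0]) (auto simp: y1_def)
    have "\<bar>y s\<bar> \<le> C + c" for s
      using bound[of s] \<open>0 \<le> c\<close> \<open>0 \<le> C\<close> by (auto simp: y_def indicator_def)
    then show "integrable lborel (\<lambda>s. pker \<gamma> (r - s) * y s)"
      using \<gamma> by (intro integrable_pker_mult[where a = 0]) (auto simp: y_def)
  qed (use \<gamma> in \<open>auto intro: integrable_pker_indicator\<close>)
  have q_nonneg: "0 \<le> q s" for s
    by (simp add: q_def)
  \<comment> \<open>Before \<tau> one has w <= 0; from \<tau> up to t1 the maximum \<epsilon> is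
    subtracted.\<close>
  have y1_nonpos: "y1 s \<le> 0" for s
    using below[of s] t0(2)[of s] t1 t0 by (auto simp: y1_def \<epsilon>_def indicator_def)
  \<comment> \<open>Restarting the convolution at \<open>t1\<close>: every summand on the right is nondecreasing, except for \<open>y\<close>,
    which is controlled by \<open>H\<close>; the first one grows at rate at least \<open>\<epsilon> * (A + 1)\<close>.\<close>
  have conv_q: "conv \<gamma> q r = \<epsilon> * conv \<gamma> (indicator {\<tau>..}) r + c * conv \<gamma> (indicator {0..}) r
      + conv \<gamma> y1 r - conv \<gamma> y r" if "r \<le> t0" for r
  proof -
    have "pker \<gamma> (r - s) * q s = \<epsilon> * (pker \<gamma> (r - s) * indicator {\<tau>..} s)
        + c * (pker \<gamma> (r - s) * indicator {0..} s) + pker \<gamma> (r - s) * y1 s - pker \<gamma> (r - s) * y s" for s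
    proof (cases "s < r")
      case True
      then have "q s = \<epsilon> * indicator {\<tau>..} s + c * indicator {0..} s + y1 s - y s"
        using pos[of s] t1 \<tau> that by (auto simp: q_def y1_def y_def indicator_def)
      then show ?thesis
        by (simp add: distrib_left right_diff_distrib mult_ac)
    qed (simp add: pker_def)
    then show ?thesis
      unfolding conv_def using int by simp
  qed
  \<comment> \<open>As time grows past t1, the kernel decreases at every point of the history, and
    it multiplies a nonpositive function.\<close>
  have y1_mono: "conv \<gamma> y1 r1 \<le> conv \<gamma> y1 r2" if "t1 < r1" "r1 < r2" for r1 r2
    unfolding conv_def
  proof (rule integral_mono)
    show "pker \<gamma> (r1 - s) * y1 s \<le> pker \<gamma> (r2 - s) * y1 s" for s
    proof (cases "s \<le> t1")
      case True
      then show ?thesis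
        using that \<gamma> y1_nonpos by (intro mult_right_mono_neg pker_antimono) auto
    qed (simp add: y1_def)
  qed (use int in auto)
  \<comment> \<open>The unit step at \<tau> contributes the rate \<epsilon> (A + 1), and
    \<open>H\<close> takes away at most \<epsilon> A.\<close>
  have q_inc: "conv \<gamma> q r1 + \<epsilon> * (r2 - r1) \<le> conv \<gamma> q r2" if r: "t1 < r1" "r1 < r2" "r2 < t0" for r1 r2
  proof -
    have "(A + 1) * ((r2 - \<tau>) - (r1 - \<tau>))
        \<le> (r2 - \<tau>) powr (1 - \<gamma>) / (1 - \<gamma>) - (r1 - \<tau>) powr (1 - \<gamma>) / (1 - \<gamma>)"
      unfolding \<rho>(2)[symmetric] using r t1 t0b \<gamma> by (intro powr_increment_lower_bound) auto
    then have "\<epsilon> * ((A + 1) * (r2 - r1)) \<le> \<epsilon> * (conv \<gamma> (indicator {\<tau>..}) r2 - conv \<gamma> (indicator {\<tau>..}) r1)"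
      using \<open>0 < \<epsilon>\<close> r t1 \<gamma> by (intro mult_left_mono) (auto simp: conv_indicator)
    moreover have "c * conv \<gamma> (indicator {0..}) r1 \<le> c * conv \<gamma> (indicator {0..}) r2"
      using \<open>0 \<le> c\<close> r t1 \<gamma>
      by (intro mult_left_mono) (auto simp: conv_indicator intro!: divide_right_mono powr_mono2)
    moreover have "conv \<gamma> y r2 - conv \<gamma> y r1 \<le> A * \<epsilon> * (r2 - r1)"
      unfolding y_def using r t1 t0b pos by (intro H[of t1 t0]) auto
    ultimately show ?thesis
      using y1_mono[OF r(1,2)] r by (simp add: conv_q algebra_simps)
  qed
  define B where "B = Beta (1 - \<gamma>) \<gamma>"
  have "0 \<le> B"
    using \<gamma> by (auto simp: B_def Beta_def intro!: divide_nonneg_nonneg Gamma_real_nonneg)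
  have Mq: "(\<integral>\<^sup>+s. ennreal (pker \<gamma> (r - s)) * ennreal (q s) \<partial>lborel) = ennreal (conv \<gamma> q r)" for r
    unfolding conv_def using int(1)[of r] q_nonneg pker_nonneg
    by (subst nn_integral_eq_integral[symmetric]) (auto simp: ennreal_mult)
  have conv_q_nonneg: "0 \<le> conv \<gamma> q r" for r
    unfolding conv_def using q_nonneg pker_nonneg by (intro Bochner_Integration.integral_nonneg) auto
  have fin: "(\<integral>\<^sup>+s. ennreal (q s) * indicator {..<t0} s \<partial>lborel) < \<infinity>"
  proof -
    have "(\<integral>\<^sup>+s. ennreal (q s) * indicator {..<t0} s \<partial>lborel)
        \<le> (\<integral>\<^sup>+s. ennreal (\<epsilon> + C) * indicator {t1..t0} s \<partial>lborel)"
    proof (intro nn_integral_mono)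
      fix s
      show "ennreal (q s) * indicator {..<t0} s \<le> ennreal (\<epsilon> + C) * indicator {t1..t0} s"
        using bound[of s] \<open>0 < \<epsilon>\<close> \<open>0 \<le> C\<close> by (auto simp: q_def indicator_def simp del: ennreal_plus intro!: ennreal_leI)
    qed
    also have "\<dots> < \<infinity>"
      using t1 by (simp add: nn_integral_cmult_indicator ennreal_mult_less_top del: ennreal_plus)
    finally show ?thesis .
  qed
  \<comment> \<open>A lower bound for the power produced by Abel inversion, uniform in \<eta> < (t0
    - t1)/2.\<close>
  define D where "D = ((t0 - t1) / 2) powr \<gamma> / \<gamma>"
  have "0 < D"
    using t1 \<gamma> by (simp add: D_def)
  \<comment> \<open>The denominator uses B + 1 because only 0 <= B is at hand; the factor 2 leaves
    room for a strict inequality.\<close>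
  define \<kappa> where "\<kappa> = \<epsilon> * D / (2 * (B + 1))"
  have \<kappa>: "0 < \<kappa>" "B * \<kappa> < \<epsilon> * D"
  proof -
    show "0 < \<kappa>"
      using \<open>0 < \<epsilon>\<close> \<open>0 < D\<close> \<open>0 \<le> B\<close> by (simp add: \<kappa>_def)
    then have "B * \<kappa> < (2 * (B + 1)) * \<kappa>"
      using \<open>0 \<le> B\<close> by (intro mult_strict_right_mono) auto
    also have "\<dots> = \<epsilon> * D"
      using \<open>0 \<le> B\<close> by (simp add: \<kappa>_def)
    finally show "B * \<kappa> < \<epsilon> * D" .
  qed
  obtain d' where d': "0 < d'" "\<And>y. \<bar>y - t0\<bar> < d' \<Longrightarrow> \<epsilon> - \<kappa> < w y"
    using w_near[of "{\<epsilon> - \<kappa><..}" t0] \<kappa> by (auto simp: \<epsilon>_def)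
  define \<eta> where "\<eta> = min d' ((t0 - t1) / 2) / 2"
  have \<eta>: "0 < \<eta>" "\<eta> < d'" "\<eta> < (t0 - t1) / 2"
    using d' t1 by (auto simp: \<eta>_def min_def)
  have "ennreal (\<epsilon> * \<eta> * ((t0 - \<eta> - t1) powr \<gamma> / \<gamma>))
      \<le> ennreal B * (\<integral>\<^sup>+s. ennreal (q s) * indicator {t0 - \<eta>..<t0} s \<partial>lborel)"
    unfolding B_def
  proof (rule Abel_increment_lower_bound[OF \<gamma>])
    show "(\<integral>\<^sup>+s. ennreal (pker \<gamma> (r1 - s)) * ennreal (q s) \<partial>lborel) + ennreal (\<epsilon> * (r2 - r1))
        \<le> (\<integral>\<^sup>+s. ennreal (pker \<gamma> (r2 - s)) * ennreal (q s) \<partial>lborel)"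
      if "t1 < r1" "r1 < r2" "r2 < t0" for r1 r2
      using q_inc[OF that] conv_q_nonneg[of r1] \<open>0 < \<epsilon>\<close> that
      by (simp add: Mq ennreal_plus[symmetric] ennreal_leI del: ennreal_plus)
  qed (use fin \<eta> t1 \<open>0 < \<epsilon>\<close> in \<open>auto simp: q_def\<close>)
  \<comment> \<open>Since w is within \<kappa> of its maximum near t0, the mass is at most \<kappa>
    \<eta>, whereas the Abel bound would force \<epsilon> D <= B \<kappa>.\<close>
  also have "(\<integral>\<^sup>+s. ennreal (q s) * indicator {t0 - \<eta>..<t0} s \<partial>lborel)
      \<le> (\<integral>\<^sup>+s. ennreal \<kappa> * indicator {t0 - \<eta>..t0} s \<partial>lborel)"
  proof (intro nn_integral_mono)
    fix s
    show "ennreal (q s) * indicator {t0 - \<eta>..<t0} s \<le> ennreal \<kappa> * indicator {t0 - \<eta>..t0} s"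
      using d'(2)[of s] \<kappa> \<eta> by (auto simp: q_def indicator_def intro!: ennreal_leI)
  qed
  also have "\<dots> = ennreal (\<kappa> * \<eta>)"
    using \<eta> \<kappa> by (simp add: nn_integral_cmult_indicator ennreal_mult)
  finally have "\<epsilon> * \<eta> * ((t0 - \<eta> - t1) powr \<gamma> / \<gamma>) \<le> B * (\<kappa> * \<eta>)"
    using \<open>0 \<le> B\<close> \<kappa> \<eta> by (simp add: ennreal_mult[symmetric] mult_left_mono)
  moreover have "D \<le> (t0 - \<eta> - t1) powr \<gamma> / \<gamma>"
    unfolding D_def using \<eta> t1 \<gamma> by (intro divide_right_mono powr_mono2) auto
  then have "\<epsilon> * \<eta> * D \<le> \<epsilon> * \<eta> * ((t0 - \<eta> - t1) powr \<gamma> / \<gamma>)"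
    using \<open>0 < \<epsilon>\<close> \<eta> by (intro mult_left_mono) auto
  moreover have "B * \<kappa> * \<eta> < \<epsilon> * D * \<eta>"
    using \<kappa> \<eta> by (intro mult_strict_right_mono) auto
  ultimately show False
    by (simp add: mult_ac)
qed

section \<open>Comparison for the generalized Caputo derivative\<close>

lemma continuous_on_clamp:
  fixes g :: "real \<Rightarrow> real"
  assumes "continuous_on {0..b} g" "0 \<le> b"
  shows "continuous_on UNIV (\<lambda>s. g (max 0 (min b s)))"
  by (rule continuous_on_compose2[OF assms(1)]) (use assms(2) in \<open>auto intro!: continuous_intros\<close>)

lemma clamp_bounded:
  fixes g :: "real \<Rightarrow> real"
  assumes "continuous_on {0..b} g" "0 \<le> b"
  obtains C where "\<And>s. \<bar>g (max 0 (min b s))\<bar> \<le> C"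
proof -
  have "bounded (g ` {0..b})"
    using assms by (intro compact_imp_bounded compact_continuous_image) auto
  then obtain C where C: "\<forall>x\<in>g ` {0..b}. norm x \<le> C"
    unfolding bounded_iff by blast
  have "\<bar>g (max 0 (min b s))\<bar> \<le> C" for s
    using C assms(2) by auto
  then show ?thesis
    by (rule that)
qed

text \<open>For t <= b the kernel sees g only on [0, t), where clamping changes nothing. Clamping
  makes the integrand Borel measurable on the line, so that Lebesgue and Borel integrals
  agree.\<close>

lemma caputo_primitive_eq_conv:
  assumes "continuous_on {0..b} g" "0 < t" "t \<le> b"
  shows "caputo_primitive \<gamma> g0 g t
    = 1 / Gamma (1 - \<gamma>) * conv \<gamma> (\<lambda>s. indicator {0..} s * (g (max 0 (min b s)) - g0)) t"
proof -
  have "continuous_on UNIV (\<lambda>s. g (max 0 (min b s)))"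
    using assms by (intro continuous_on_clamp) auto
  then have [measurable]: "(\<lambda>s. g (max 0 (min b s))) \<in> borel_measurable borel"
    by (rule borel_measurable_continuous_onI)
  have "(LINT s:{0..t}|lebesgue. (t - s) powr (- \<gamma>) * (g s - g0))
      = (LINT s|lebesgue. pker \<gamma> (t - s) * (indicator {0..} s * (g (max 0 (min b s)) - g0)))"
    unfolding set_lebesgue_integral_def
    by (intro Bochner_Integration.integral_cong) (use assms in \<open>auto simp: indicator_def pker_def\<close>)
  also have "\<dots> = conv \<gamma> (\<lambda>s. indicator {0..} s * (g (max 0 (min b s)) - g0)) t"
    unfolding conv_def by (intro integral_completion) measurable
  finally show ?thesis
    using assms by (simp add: caputo_primitive_def)
qed

text \<open>By linearity; subtracting the two initial values leaves the constant that becomes c in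
  the maximum principle.\<close>

lemma caputo_primitive_diff:
  assumes "0 < \<gamma>" "\<gamma> < 1" and g: "continuous_on {0..b} g" and h: "continuous_on {0..b} h"
    and "0 < t" "t \<le> b"
  shows "caputo_primitive \<gamma> (g 0) g t - caputo_primitive \<gamma> (h 0) h t
    = 1 / Gamma (1 - \<gamma>) * conv \<gamma> (\<lambda>s. indicator {0..} s *
        (g (max 0 (min b s)) - h (max 0 (min b s)) + (h 0 - g 0))) t"
proof -
  have int: "integrable lborel (\<lambda>s. pker \<gamma> (t - s) * (indicator {0..} s * (g (max 0 (min b s)) - g 0)))"
    if c: "continuous_on {0..b} g" for g
  proof -
    obtain C where C: "\<And>s. \<bar>g (max 0 (min b s))\<bar> \<le> C"
      using clamp_bounded[OF c] assms by auto
    have "\<bar>indicator {0..} s * (g (max 0 (min b s)) - g 0)\<bar> \<le> C + \<bar>g 0\<bar>" for s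
      using C[of s] abs_triangle_ineq4[of "g (max 0 (min b s))" "g 0"] by (auto simp: indicator_def)
    moreover have "continuous_on UNIV (\<lambda>s. g (max 0 (min b s)))"
      using c assms by (intro continuous_on_clamp) auto
    then have [measurable]: "(\<lambda>s. g (max 0 (min b s))) \<in> borel_measurable borel"
      by (rule borel_measurable_continuous_onI)
    ultimately show ?thesis
      using assms by (intro integrable_pker_mult[where a = 0]) auto
  qed
  show ?thesis
    unfolding caputo_primitive_eq_conv[OF g assms(5,6)] caputo_primitive_eq_conv[OF h assms(5,6)]
      right_diff_distrib[symmetric] conv_def
      Bochner_Integration.integral_diff[OF int[OF g] int[OF h], symmetric]
    by (simp add: algebra_simps)
qed

lemma continuous_on_caputo_primitive:
  assumes "0 < \<gamma>" "\<gamma> < 1" and g: "continuous_on {0..b} g" and "0 < \<alpha>" "\<beta> \<le> b"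
  shows "continuous_on {\<alpha>..\<beta>} (caputo_primitive \<gamma> g0 g)"
proof (cases "\<alpha> \<le> \<beta>")
  case True
  then obtain C where C: "\<And>s. \<bar>g (max 0 (min b s))\<bar> \<le> C"
    using clamp_bounded[OF g] assms by auto
  have "\<bar>indicator {0..} s * (g (max 0 (min b s)) - g0)\<bar> \<le> C + \<bar>g0\<bar>" for s
    using C[of s] abs_triangle_ineq4[of "g (max 0 (min b s))" g0] by (auto simp: indicator_def)
  moreover have "continuous_on UNIV (\<lambda>s. g (max 0 (min b s)))"
    using g assms True by (intro continuous_on_clamp) auto
  then have [measurable]: "(\<lambda>s. g (max 0 (min b s))) \<in> borel_measurable borel"
    by (rule borel_measurable_continuous_onI)
  ultimately have "continuous_on {0..} (conv \<gamma> (\<lambda>s. indicator {0..} s * (g (max 0 (min b s)) - g0)))"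
    using assms by (intro continuous_on_conv) auto
  then have "continuous_on {\<alpha>..\<beta>} (conv \<gamma> (\<lambda>s. indicator {0..} s * (g (max 0 (min b s)) - g0)))"
    by (rule continuous_on_subset) (use assms in auto)
  then have "continuous_on {\<alpha>..\<beta>}
      (\<lambda>t. 1 / Gamma (1 - \<gamma>) * conv \<gamma> (\<lambda>s. indicator {0..} s * (g (max 0 (min b s)) - g0)) t)"
    by (intro continuous_intros)
  then show ?thesis
    by (rule continuous_on_eq) (use assms in \<open>auto simp: caputo_primitive_eq_conv\<close>)
qed simp

text \<open>Comparing the two residuals, derivative minus right-hand side, makes the statement serve
  both halves of the theorem: the exact solution may be either the lower or the upper function. The
  horizons Tx and Tz may differ, since testing takes place on (0, T).\<close>

lemma caputo_comparison:
  fixes f :: "real \<Rightarrow> real \<Rightarrow> real"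
  assumes \<gamma>: "0 < \<gamma>" "\<gamma> < 1"
    and f: "continuous_on ({0..} \<times> UNIV) (\<lambda>(t, x). f t x)" and lip: "locally_lipschitz_snd f"
    and x: "continuous_on (time_interval T) x" and z: "continuous_on (time_interval T) z"
    and T: "T \<le> Tx" "T \<le> Tz" and "x 0 \<le> z 0"
    and le: "\<And>\<phi>. \<phi> \<in> test_functions (einterval 0 T) \<Longrightarrow> (\<forall>t. 0 \<le> \<phi> t) \<Longrightarrow>
      caputo \<gamma> Tx (x 0) x \<phi> - (LINT t:einterval 0 T|lebesgue. f t (x t) * \<phi> t)
        \<le> caputo \<gamma> Tz (z 0) z \<phi> - (LINT t:einterval 0 T|lebesgue. f t (z t) * \<phi> t)"
    and t: "t \<in> time_interval T"
  shows "x t \<le> z t"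
proof -
  have "0 \<le> t" "ereal t < T"
    using t by (auto simp: time_interval_def)
  \<comment> \<open>A horizon strictly between t and T gives a compact interval, hence bounds on
    both functions and a single Lipschitz constant.\<close>
  then obtain b where b: "t < b" "ereal b < T"
    using ereal_dense2[of "ereal t" T] by auto
  have "0 < b"
    using b \<open>0 \<le> t\<close> by linarith
  have sub: "{0..b} \<subseteq> time_interval T"
    using b order.strict_trans1[of "ereal _" "ereal b" T] by (auto simp: time_interval_def)
  note x = continuous_on_subset[OF x sub] and z = continuous_on_subset[OF z sub]
  obtain Mx where Mx: "\<And>s. \<bar>x (max 0 (min b s))\<bar> \<le> Mx"
    using clamp_bounded[OF x] \<open>0 < b\<close> by auto
  obtain Mz where Mz: "\<And>s. \<bar>z (max 0 (min b s))\<bar> \<le> Mz"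
    using clamp_bounded[OF z] \<open>0 < b\<close> by auto
  define M where "M = max Mx Mz"
  obtain L where L: "\<And>t. t \<in> {0..b} \<Longrightarrow> L-lipschitz_on {-M..M} (f t)"
    using lip unfolding locally_lipschitz_snd_def by metis
  have "0 \<le> L"
    using L[of 0] \<open>0 < b\<close> lipschitz_on_nonneg by auto
  have f_le: "f s (x s) - f s (z s) \<le> L * \<epsilon>" if "s \<in> {0..b}" "0 < x s - z s" "x s - z s \<le> \<epsilon>" for s \<epsilon>
  proof -
    have "x s \<in> {-M..M}" "z s \<in> {-M..M}"
      using Mx[of s] Mz[of s] that by (auto simp: M_def)
    then have "\<bar>f s (x s) - f s (z s)\<bar> \<le> L * \<bar>x s - z s\<bar>"
      using lipschitz_onD[OF L[OF that(1)]] by (auto simp: dist_real_def)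
    also have "\<dots> \<le> L * \<epsilon>"
      using that \<open>0 \<le> L\<close> by (intro mult_left_mono) auto
    finally show ?thesis
      by linarith
  qed
  define w where "w = (\<lambda>s. x (max 0 (min b s)) - z (max 0 (min b s)))"
  define y where "y = (\<lambda>s. indicator {0..} s * (w s + (z 0 - x 0)))"
  define N where "N = (\<lambda>s. caputo_primitive \<gamma> (x 0) x s - caputo_primitive \<gamma> (z 0) z s)"
  have \<Gamma>: "0 < Gamma (1 - \<gamma>)"
    using \<gamma> by simp
  have N_eq: "N s = 1 / Gamma (1 - \<gamma>) * conv \<gamma> y s" if "0 < s" "s \<le> b" for s
    unfolding N_def y_def w_def by (rule caputo_primitive_diff[OF \<gamma> x z that])
  have conv_le: "conv \<gamma> y t2 - conv \<gamma> y t1 \<le> Gamma (1 - \<gamma>) * L * \<epsilon> * (t2 - t1)"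
    if \<alpha>: "0 < \<alpha>" "\<beta> < b" and w: "\<And>t. t \<in> {\<alpha><..<\<beta>} \<Longrightarrow> 0 < w t \<and> w t \<le> \<epsilon>"
      and t12: "\<alpha> < t1" "t1 < t2" "t2 < \<beta>" for \<alpha> \<beta> \<epsilon> t1 t2
  proof -
    have I: "{\<alpha><..<\<beta>} \<subseteq> einterval 0 T" "einterval 0 T \<subseteq> einterval (-\<infinity>) Tx" "einterval 0 T \<subseteq> einterval (-\<infinity>) Tz"
      using \<alpha> b T less_trans[of "ereal _" "ereal b" T] by (auto simp: einterval_def intro: less_le_trans)
    have cx: "continuous_on {\<alpha>..\<beta>} (caputo_primitive \<gamma> (x 0) x)"
      and cz: "continuous_on {\<alpha>..\<beta>} (caputo_primitive \<gamma> (z 0) z)"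
      using \<alpha> by (auto intro!: continuous_on_caputo_primitive[OF \<gamma>] x z)
    have cf: "continuous_on {\<alpha>..\<beta>} (\<lambda>s. f s (g s))" if "continuous_on {0..b} g" for g
    proof -
      have "continuous_on {\<alpha>..\<beta>} (\<lambda>s. case (s, g s) of (t, x) \<Rightarrow> f t x)"
        using \<alpha> continuous_on_subset[OF that, of "{\<alpha>..\<beta>}"]
        by (intro continuous_on_compose2[OF f] continuous_intros) auto
      then show ?thesis
        by simp
    qed
    \<comment> \<open>On (\<alpha>, \<beta>) the distributional derivative of N is at most f(s, x) -
      f(s, z), which the Lipschitz bound keeps below L \<epsilon>.\<close>
    have "N t2 - N t1 \<le> (L * \<epsilon>) * (t2 - t1)"
    proof (rule distr_deriv_le_const_imp_increment_le[OF _ _ t12])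
      show "continuous_on {\<alpha><..<\<beta>} N"
        unfolding N_def by (intro continuous_intros continuous_on_subset[OF cx] continuous_on_subset[OF cz]) auto
      fix \<phi> assume \<phi>: "\<phi> \<in> test_functions {\<alpha><..<\<beta>}" "\<forall>x. 0 \<le> \<phi> x"
      note c\<phi> = test_function_continuous[OF \<phi>(1)] and z\<phi> = test_function_eq_0[OF \<phi>(1)]
      \<comment> \<open>The pairings live on different open sets; as \<phi> and its derivative
        vanish off (\<alpha>, \<beta>), all of them become integrals over the same compact
        interval.\<close>
      have restrict: "(LINT s:U|lebesgue. g s * \<psi> s) = integral {\<alpha>..\<beta>} (\<lambda>s. g s * \<psi> s)"
        if "continuous_on {\<alpha>..\<beta>} g" "\<psi> \<in> {\<phi>, deriv \<phi>}" "{\<alpha><..<\<beta>} \<subseteq> U" for U g \<psi>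
      proof (rule set_integral_eq_integral_of_support)
        show "continuous_on {\<alpha>..\<beta>} (\<lambda>s. g s * \<psi> s)"
          using that c\<phi> by (auto intro!: continuous_intros)
        fix s assume "s \<notin> {\<alpha>..\<beta>} \<inter> U"
        then have "s \<notin> {\<alpha><..<\<beta>}"
          using that(3) by auto
        then show "g s * \<psi> s = 0"
          using z\<phi> that(2) by auto
      qed
      have int: "(\<lambda>s. g s * \<psi> s) integrable_on {\<alpha>..\<beta>}"
        if "continuous_on {\<alpha>..\<beta>} g" "\<psi> \<in> {\<phi>, deriv \<phi>}" for g \<psi>
        using that c\<phi> by (auto intro!: integrable_continuous_interval continuous_intros)
      have "\<phi> \<in> test_functions (einterval 0 T)"
        using \<phi>(1) test_functions_mono[OF I(1)] by blast
      from le[OF this \<phi>(2)]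
      have "- integral {\<alpha>..\<beta>} (\<lambda>s. caputo_primitive \<gamma> (x 0) x s * deriv \<phi> s)
            - integral {\<alpha>..\<beta>} (\<lambda>s. f s (x s) * \<phi> s)
          \<le> - integral {\<alpha>..\<beta>} (\<lambda>s. caputo_primitive \<gamma> (z 0) z s * deriv \<phi> s)
            - integral {\<alpha>..\<beta>} (\<lambda>s. f s (z s) * \<phi> s)"
        using I cx cz cf[OF x] cf[OF z]
        by (simp add: caputo_def distr_deriv_def regular_distr_def restrict)
      moreover have "integral {\<alpha>..\<beta>} (\<lambda>s. N s * deriv \<phi> s)
          = integral {\<alpha>..\<beta>} (\<lambda>s. caputo_primitive \<gamma> (x 0) x s * deriv \<phi> s)
            - integral {\<alpha>..\<beta>} (\<lambda>s. caputo_primitive \<gamma> (z 0) z s * deriv \<phi> s)"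
        unfolding N_def left_diff_distrib using cx cz
        by (intro Henstock_Kurzweil_Integration.integral_diff int) auto
      moreover have "integral {\<alpha>..\<beta>} (\<lambda>s. f s (x s) * \<phi> s) - integral {\<alpha>..\<beta>} (\<lambda>s. f s (z s) * \<phi> s)
          = integral {\<alpha>..\<beta>} (\<lambda>s. (f s (x s) - f s (z s)) * \<phi> s)"
        unfolding left_diff_distrib using cf[OF x] cf[OF z]
        by (intro Henstock_Kurzweil_Integration.integral_diff[symmetric] int) auto
      moreover have "\<dots> \<le> integral {\<alpha>..\<beta>} (\<lambda>s. (L * \<epsilon>) * \<phi> s)"
      proof (rule integral_le)
        show "(\<lambda>s. (f s (x s) - f s (z s)) * \<phi> s) integrable_on {\<alpha>..\<beta>}"
          using cf[OF x] cf[OF z] by (intro int continuous_intros) auto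
        show "(\<lambda>s. (L * \<epsilon>) * \<phi> s) integrable_on {\<alpha>..\<beta>}"
          by (rule int) auto
        fix s assume s: "s \<in> {\<alpha>..\<beta>}"
        show "(f s (x s) - f s (z s)) * \<phi> s \<le> (L * \<epsilon>) * \<phi> s"
        proof (cases "s \<in> {\<alpha><..<\<beta>}")
          case True
          then have "f s (x s) - f s (z s) \<le> L * \<epsilon>"
            using w[OF True] \<alpha> by (intro f_le) (auto simp: w_def)
          then show ?thesis
            using \<phi>(2) by (intro mult_right_mono) auto
        qed (use z\<phi> in auto)
      qed
      moreover have "(LINT s:{\<alpha><..<\<beta>}|lebesgue. N s * deriv \<phi> s) = integral {\<alpha>..\<beta>} (\<lambda>s. N s * deriv \<phi> s)"
        unfolding N_def using cx cz by (intro restrict continuous_intros) auto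
      moreover have "(LINT s:{\<alpha><..<\<beta>}|lebesgue. \<phi> s) = integral {\<alpha>..\<beta>} \<phi>"
        using restrict[of "\<lambda>_. 1" \<phi>] by simp
      ultimately show "- (LINT s:{\<alpha><..<\<beta>}|lebesgue. N s * deriv \<phi> s)
          \<le> (L * \<epsilon>) * (LINT s:{\<alpha><..<\<beta>}|lebesgue. \<phi> s)"
        by simp
    qed
    then have "Gamma (1 - \<gamma>) * (N t2 - N t1) \<le> Gamma (1 - \<gamma>) * ((L * \<epsilon>) * (t2 - t1))"
      using \<Gamma> by (intro mult_left_mono) auto
    moreover have "Gamma (1 - \<gamma>) * (N t2 - N t1) = conv \<gamma> y t2 - conv \<gamma> y t1"
      using \<Gamma> \<alpha> t12 by (simp add: N_eq right_diff_distrib)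
    ultimately show ?thesis
      by (simp add: mult.assoc)
  qed
  have "w t \<le> 0"
  \<comment> \<open>Here w(0) = -c, and the rate A is \<Gamma>(1 - \<gamma>) L because the Caputo
    primitive carries the factor 1/\<Gamma>(1 - \<gamma>).\<close>
  proof (rule fractional_maximum_principle[OF \<gamma>, where c = "z 0 - x 0" and b = b and w = w])
    have "continuous_on UNIV (\<lambda>s. g (max 0 (min b s)))" if "continuous_on {0..b} g" for g :: "real \<Rightarrow> real"
      using that \<open>0 < b\<close> by (intro continuous_on_clamp) auto
    then show "continuous_on UNIV w"
      unfolding w_def using x z by (intro continuous_intros) auto
    show "\<bar>w s\<bar> \<le> Mx + Mz" for s
      using Mx[of s] Mz[of s] unfolding w_def by linarith
    show "0 \<le> Gamma (1 - \<gamma>) * L"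
      using \<Gamma> \<open>0 \<le> L\<close> by simp
  qed (use conv_le[unfolded y_def] \<open>x 0 \<le> z 0\<close> \<open>0 < b\<close> \<open>0 \<le> t\<close> b(1) in \<open>auto simp: w_def\<close>)
  then show ?thesis
    using \<open>0 \<le> t\<close> b by (simp add: w_def)
qed

text \<open>The averages of |u - u0| over [0, t] tend to 0 by definition, and to |u(0) - u0| by
  continuity, being difference quotients at 0 of the integral.\<close>

lemma strong_solution_initial_value:
  assumes "strong_solution \<gamma> f u0 T u" "continuous_on (time_interval T) u"
  shows "u 0 = u0"
proof -
  have "0 < T" and lim: "((\<lambda>t. 1 / t * (LINT s:{0..t}|lebesgue. \<bar>u s - u0\<bar>)) \<longlongrightarrow> 0) (at_right 0)"
    using assms(1) by (auto simp: strong_solution_def)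
  then obtain b where b: "0 < b" "ereal b < T"
    using ereal_dense2[of 0 T] by auto
  have "{0..b} \<subseteq> time_interval T"
    using b order.strict_trans1[of "ereal _" "ereal b" T] by (auto simp: time_interval_def)
  then have c: "continuous_on {0..b} (\<lambda>s. \<bar>u s - u0\<bar>)"
    using assms(2) by (intro continuous_intros) (rule continuous_on_subset)
  have "((\<lambda>t. integral {0..t} (\<lambda>s. \<bar>u s - u0\<bar>)) has_real_derivative \<bar>u 0 - u0\<bar>) (at 0 within {0..b})"
    using c b by (intro integral_has_real_derivative) auto
  then have "((\<lambda>t. integral {0..t} (\<lambda>s. \<bar>u s - u0\<bar>) / t) \<longlongrightarrow> \<bar>u 0 - u0\<bar>) (at_right 0)"
    using b by (simp add: has_field_derivative_iff at_within_Icc_at_right)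
  moreover have "eventually (\<lambda>t. t \<in> {0<..<b}) (at_right 0)"
    using b by (intro eventually_at_right_real)
  then have "eventually (\<lambda>t. integral {0..t} (\<lambda>s. \<bar>u s - u0\<bar>) / t
      = 1 / t * (LINT s:{0..t}|lebesgue. \<bar>u s - u0\<bar>)) (at_right 0)"
  proof eventually_elim
    case (elim t)
    then have "(LINT s:{0..t}|lebesgue. \<bar>u s - u0\<bar>) = integral {0..t} (\<lambda>s. \<bar>u s - u0\<bar>)"
      by (intro set_lebesgue_integral_eq_integral absolutely_integrable_continuous_real
          continuous_on_subset[OF c]) auto
    then show ?case
      by simp
  qed
  ultimately have "((\<lambda>t. 1 / t * (LINT s:{0..t}|lebesgue. \<bar>u s - u0\<bar>)) \<longlongrightarrow> \<bar>u 0 - u0\<bar>) (at_right 0)"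
    by (rule Lim_transform_eventually)
  then have "\<bar>u 0 - u0\<bar> = 0"
    using lim by (intro tendsto_unique[OF trivial_limit_at_right_real])
  then show ?thesis
    by simp
qed

theorem theorem2p2:
  fixes \<gamma> u0 :: real and f :: "real \<Rightarrow> real \<Rightarrow> real"
    and u v :: "real \<Rightarrow> real" and T\<^sub>v T\<^sub>b :: ereal
  assumes "0 < \<gamma>" and "\<gamma> < 1"
    and "continuous_on ({0..} \<times> UNIV) (\<lambda>(t, x). f t x)"
    and "locally_lipschitz_snd f"
    and "0 < T\<^sub>v" and "continuous_on (time_interval T\<^sub>v) v"
    and "maximal_strong_solution \<gamma> f u0 T\<^sub>b u"
  shows "(distr_le_on (einterval 0 T\<^sub>v)
            (caputo \<gamma> T\<^sub>v (v 0) v) (regular_distr (einterval 0 T\<^sub>v) (\<lambda>t. f t (v t))) \<and>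
          v 0 \<le> u0 \<longrightarrow>
          (\<forall>t\<in>time_interval (min T\<^sub>v T\<^sub>b). v t \<le> u t)) \<and>
         (distr_le_on (einterval 0 T\<^sub>v)
            (regular_distr (einterval 0 T\<^sub>v) (\<lambda>t. f t (v t))) (caputo \<gamma> T\<^sub>v (v 0) v) \<and>
          v 0 \<ge> u0 \<longrightarrow>
          (\<forall>t\<in>time_interval (min T\<^sub>v T\<^sub>b). v t \<ge> u t))"
proof -
  define T where "T = min T\<^sub>v T\<^sub>b"
  have T: "T \<le> T\<^sub>v" "T \<le> T\<^sub>b"
    by (simp_all add: T_def)
  have sol: "strong_solution \<gamma> f u0 T\<^sub>b u" and cu: "continuous_on (time_interval T\<^sub>b) u"
    using assms(7) by (auto simp: maximal_strong_solution_def)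
  have u0: "u 0 = u0"
    by (rule strong_solution_initial_value[OF sol cu])
  have sub: "time_interval T \<subseteq> time_interval T\<^sub>v" "time_interval T \<subseteq> time_interval T\<^sub>b"
    using T by (auto simp: time_interval_def intro: less_le_trans)
  have cv: "continuous_on (time_interval T) v" and cu: "continuous_on (time_interval T) u"
    using assms(6) cu sub continuous_on_subset by blast+
  have mono: "\<phi> \<in> test_functions (einterval 0 T\<^sub>v)" "\<phi> \<in> test_functions (einterval (-\<infinity>) T\<^sub>b)"
    if "\<phi> \<in> test_functions (einterval 0 T)" for \<phi>
  proof -
    have "einterval 0 T \<subseteq> einterval 0 T\<^sub>v" "einterval 0 T \<subseteq> einterval (-\<infinity>) T\<^sub>b"
      using T by (auto simp: einterval_def intro: less_le_trans)
    then show "\<phi> \<in> test_functions (einterval 0 T\<^sub>v)" "\<phi> \<in> test_functions (einterval (-\<infinity>) T\<^sub>b)"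
      using that test_functions_mono by blast+
  qed
  \<comment> \<open>A test function on (0, T) ignores everything outside, in particular the
    extension by zero to negative times.\<close>
  have restrict: "regular_distr (einterval 0 T\<^sub>v) h \<phi> = (LINT t:einterval 0 T|lebesgue. h t * \<phi> t)"
    "regular_distr (einterval (-\<infinity>) T\<^sub>b) (zero_ext h) \<phi> = (LINT t:einterval 0 T|lebesgue. h t * \<phi> t)"
    if "\<phi> \<in> test_functions (einterval 0 T)" for h \<phi>
    unfolding regular_distr_def set_lebesgue_integral_def
    using test_function_eq_0(1)[OF that] T
    by (auto intro!: Bochner_Integration.integral_cong
        simp: indicator_def zero_ext_def einterval_def intro: less_le_trans)
  \<comment> \<open>The residual of u is zero, so it can stand on either side of the
    comparison.\<close>
  have eq: "caputo \<gamma> T\<^sub>b (u 0) u \<phi> - (LINT t:einterval 0 T|lebesgue. f t (u t) * \<phi> t) = 0"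
    if "\<phi> \<in> test_functions (einterval 0 T)" for \<phi>
    using sol mono(2)[OF that] restrict(2)[OF that, of "\<lambda>t. f t (u t)"]
    by (simp add: strong_solution_def distr_eq_on_def u0)
  have "v t \<le> u t"
    if le: "distr_le_on (einterval 0 T\<^sub>v) (caputo \<gamma> T\<^sub>v (v 0) v)
        (regular_distr (einterval 0 T\<^sub>v) (\<lambda>t. f t (v t)))"
      and "v 0 \<le> u0" "t \<in> time_interval T" for t
  proof (rule caputo_comparison[OF assms(1-4) cv cu T])
    fix \<phi> assume \<phi>: "\<phi> \<in> test_functions (einterval 0 T)" "\<forall>t. 0 \<le> \<phi> t"
    have "caputo \<gamma> T\<^sub>v (v 0) v \<phi> - regular_distr (einterval 0 T\<^sub>v) (\<lambda>t. f t (v t)) \<phi> \<le> 0"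
      using le mono(1)[OF \<phi>(1)] \<phi>(2) by (auto simp: distr_le_on_def)
    then show "caputo \<gamma> T\<^sub>v (v 0) v \<phi> - (LINT t:einterval 0 T|lebesgue. f t (v t) * \<phi> t)
        \<le> caputo \<gamma> T\<^sub>b (u 0) u \<phi> - (LINT t:einterval 0 T|lebesgue. f t (u t) * \<phi> t)"
      using eq[OF \<phi>(1)] restrict(1)[OF \<phi>(1), of "\<lambda>t. f t (v t)"] by simp
  qed (use that u0 in auto)
  moreover have "u t \<le> v t"
    if le: "distr_le_on (einterval 0 T\<^sub>v) (regular_distr (einterval 0 T\<^sub>v) (\<lambda>t. f t (v t)))
        (caputo \<gamma> T\<^sub>v (v 0) v)"
      and "u0 \<le> v 0" "t \<in> time_interval T" for t
  \<comment> \<open>The roles are exchanged: u is now the lower function and v the upper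
    one.\<close>
  proof (rule caputo_comparison[OF assms(1-4) cu cv T(2,1)])
    fix \<phi> assume \<phi>: "\<phi> \<in> test_functions (einterval 0 T)" "\<forall>t. 0 \<le> \<phi> t"
    have "regular_distr (einterval 0 T\<^sub>v) (\<lambda>t. f t (v t)) \<phi> - caputo \<gamma> T\<^sub>v (v 0) v \<phi> \<le> 0"
      using le mono(1)[OF \<phi>(1)] \<phi>(2) by (auto simp: distr_le_on_def)
    then show "caputo \<gamma> T\<^sub>b (u 0) u \<phi> - (LINT t:einterval 0 T|lebesgue. f t (u t) * \<phi> t)
        \<le> caputo \<gamma> T\<^sub>v (v 0) v \<phi> - (LINT t:einterval 0 T|lebesgue. f t (v t) * \<phi> t)"
      using eq[OF \<phi>(1)] restrict(1)[OF \<phi>(1), of "\<lambda>t. f t (v t)"] by simp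
  qed (use that u0 in auto)
  ultimately show ?thesis
    by (simp add: T_def)
qed

end
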